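(* Let $(X,\mathcal{T})$ be a topological dynamical system, where $\mathcal{T}=\{T^h\}_{h\in L}$ is a continuous $L$-action on a compact metric space $X$ with $L=\mathbb{Z}^d$ or $L=\mathbb{Z}_+^d$, $d\geq 1$, and let $K\subset X$ be any non-empty compact subset. Then $$h^S_{top}(\mathcal{T},K)=\sup\{\underline{h}_\mu^S(\mathcal{T}):\mu\in \mathcal{M}(X),\ \mu(K)=1\}.$$
   Context: Let $(X,\rho)$ be a compact metric space, $\mathbb{Z}_+$ the set of non-negative integers, and $L=\mathbb{Z}^d$ or $\mathbb{Z}_+^d$ with $d\ge 1$. A continuous $L$-action $\mathcal{T}=\{T^h:X\to X\}_{h\in L}$ is a family of continuous maps with $T^{h+k}=T^h\circ T^k$ for $h,k\in L$ and $T^0=\mathrm{id}$. $\mathcal{M}(X)$ is the set of all Borel probability measures on $X$ (not necessarily invariant). For $n\in\mathbb{N}$ put $H_n=\{h=(h_1,\dots,h_d)\in L:|h_i|<n,\ 1\le i\le d\}$, $\lambda_n=\#H_n$, $\rho_n(x,y)=\max_{h\in H_n}\rho(T^hx,T^hy)$ and $B_n(x,\epsilon)=\{y\in X:\rho_n(x,y)<\epsilon\}$ (open Bowen ball). Topological slow entropy: for $Z\subset X$, $s\ge 0$, $N\in\mathbb{N}$, $\epsilon>0$ let $$M(Z,s,N,\epsilon)=\inf\sum_i\left(\frac{1}{\lambda_{n_i}}\right)^s,$$ the infimum taken over all finite or countable families $\{B_{n_i}(x_i,\epsilon)\}$ with $x_i\in X$, $n_i\ge N$ and $\bigcup_iB_{n_i}(x_i,\epsilon)\supset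 Z$. Let $M(Z,s,\epsilon)=\lim_{N\to\infty}M(Z,s,N,\epsilon)$, $$h^S_{top}(\mathcal{T},Z,\epsilon)=\inf\{s\ge0:M(Z,s,\epsilon)=0\}=\sup\{s\ge0:M(Z,s,\epsilon)=\infty\}$$ (with $\inf\emptyset=+\infty$, $\sup\emptyset=0$), and $h^S_{top}(\mathcal{T},Z)=\lim_{\epsilon\to0}h^S_{top}(\mathcal{T},Z,\epsilon)\in[0,\infty]$. Measure-theoretic slow entropy: for $\mu\in\mathcal{M}(X)$, $$\underline{h}_\mu^S(\mathcal{T},x)=\lim_{\epsilon\to0}\liminf_{n\to\infty}-\frac{1}{\log\lambda_n}\log\mu(B_n(x,\epsilon)),\qquad \underline{h}_\mu^S(\mathcal{T})=\int\underline{h}_\mu^S(\mathcal{T},x)\,d\mu(x).$$ *)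

theory Defs
  imports "HOL-Probability.Probability"
begin

text \<open>
  The compact metric space \<open>X\<close> is the universe of a type of class \<open>metric_space\<close> for
  which \<open>UNIV\<close> is compact. The dimension \<open>d \<ge> 1\<close> is \<open>CARD('d)\<close>. The semigroup \<open>L\<close> is a subset of
  \<open>int ^ 'd\<close>, and only the values \<open>T h\<close> with \<open>h \<in> L\<close> are ever used.

  The time \<open>n\<close> is a positive integer in the mathematics. At \<open>n = 0\<close> the quantities below take junk
  values, and at \<open>n = 1\<close> one has \<open>ln \<lambda>\<^sub>1 = 0\<close>. Neither matters, since both entropies depend only on
  arbitrarily large \<open>n\<close>.

  The limits as \<open>N \<rightarrow> \<infinity>\<close> and as \<open>\<epsilon> \<rightarrow> 0\<close> always exist in \<open>ennreal\<close>: the quantities increase with \<open>N\<close>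
  and as \<open>\<epsilon>\<close> decreases.
\<close>

definition nonneg_lattice :: "(int ^ 'd) set" where
  "nonneg_lattice = {h. \<forall>i. 0 \<le> h $ i}"

definition continuous_action :: "(int ^ 'd) set \<Rightarrow> (int ^ 'd \<Rightarrow> 'a \<Rightarrow> 'a::topological_space) \<Rightarrow> bool" where
  "continuous_action L T \<longleftrightarrow>
     (\<forall>h\<in>L. continuous_on UNIV (T h)) \<and>
     (\<forall>h\<in>L. \<forall>k\<in>L. T (h + k) = T h \<circ> T k) \<and>
     T 0 = id"

definition time_box :: "(int ^ 'd) set \<Rightarrow> nat \<Rightarrow> (int ^ 'd) set" where
  "time_box L n = {h \<in> L. \<forall>i. \<bar>h $ i\<bar> < int n}"

definition time_box_size :: "(int ^ 'd) set \<Rightarrow> nat \<Rightarrow> nat" where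
  "time_box_size L n = card (time_box L n)"

definition bowen_dist ::
  "(int ^ 'd) set \<Rightarrow> (int ^ 'd \<Rightarrow> 'a \<Rightarrow> 'a::metric_space) \<Rightarrow> nat \<Rightarrow> 'a \<Rightarrow> 'a \<Rightarrow> real" where
  "bowen_dist L T n x y = Max ((\<lambda>h. dist (T h x) (T h y)) ` time_box L n)"

definition bowen_ball ::
  "(int ^ 'd) set \<Rightarrow> (int ^ 'd \<Rightarrow> 'a \<Rightarrow> 'a::metric_space) \<Rightarrow> nat \<Rightarrow> 'a \<Rightarrow> real \<Rightarrow> 'a set" where
  "bowen_ball L T n x \<epsilon> = {y. bowen_dist L T n x y < \<epsilon>}"

text \<open>
  A finite or countable family of Bowen balls is given by an index set \<open>I \<subseteq> \<nat>\<close>, centres \<open>c i\<close> and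
  times \<open>m i\<close>.
\<close>

definition slow_cover_sum_at ::
  "(int ^ 'd) set \<Rightarrow> (int ^ 'd \<Rightarrow> 'a \<Rightarrow> 'a::metric_space) \<Rightarrow> 'a set \<Rightarrow> real \<Rightarrow> nat \<Rightarrow> real \<Rightarrow> ennreal" where
  "slow_cover_sum_at L T Z s N \<epsilon> =
     Inf {(\<Sum>\<^sub>\<infinity>i\<in>I. ennreal ((1 / real (time_box_size L (m i))) powr s)) | (I :: nat set) c m.
            (\<forall>i\<in>I. N \<le> m i) \<and> Z \<subseteq> (\<Union>i\<in>I. bowen_ball L T (m i) (c i) \<epsilon>)}"

definition slow_cover_sum ::
  "(int ^ 'd) set \<Rightarrow> (int ^ 'd \<Rightarrow> 'a \<Rightarrow> 'a::metric_space) \<Rightarrow> 'a set \<Rightarrow> real \<Rightarrow> real \<Rightarrow> ennreal" where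
  "slow_cover_sum L T Z s \<epsilon> = lim (\<lambda>N. slow_cover_sum_at L T Z s N \<epsilon>)"

definition slow_entropy_top_at ::
  "(int ^ 'd) set \<Rightarrow> (int ^ 'd \<Rightarrow> 'a \<Rightarrow> 'a::metric_space) \<Rightarrow> 'a set \<Rightarrow> real \<Rightarrow> ennreal" where
  "slow_entropy_top_at L T Z \<epsilon> = Inf {ennreal s | s. 0 \<le> s \<and> slow_cover_sum L T Z s \<epsilon> = 0}"

definition slow_entropy_top ::
  "(int ^ 'd) set \<Rightarrow> (int ^ 'd \<Rightarrow> 'a \<Rightarrow> 'a::metric_space) \<Rightarrow> 'a set \<Rightarrow> ennreal" where
  "slow_entropy_top L T Z = Lim (at_right 0) (\<lambda>\<epsilon>. slow_entropy_top_at L T Z \<epsilon>)"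

text \<open>
  \<open>- log p\<close> for a probability \<open>p\<close>, with \<open>- log 0 = \<infinity>\<close>; the real \<open>ln\<close> satisfies \<open>ln 0 = 0\<close>.
\<close>

definition neg_ln :: "real \<Rightarrow> ennreal" where
  "neg_ln p = (if p = 0 then \<infinity> else ennreal (- ln p))"

definition lower_slow_entropy_at ::
  "(int ^ 'd) set \<Rightarrow> (int ^ 'd \<Rightarrow> 'a \<Rightarrow> 'a::metric_space) \<Rightarrow> 'a measure \<Rightarrow> 'a \<Rightarrow> ennreal" where
  "lower_slow_entropy_at L T \<mu> x =
     Lim (at_right 0) (\<lambda>\<epsilon>. liminf (\<lambda>n.
       neg_ln (measure \<mu> (bowen_ball L T n x \<epsilon>)) / ennreal (ln (real (time_box_size L n)))))"

definition lower_slow_entropy ::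
  "(int ^ 'd) set \<Rightarrow> (int ^ 'd \<Rightarrow> 'a \<Rightarrow> 'a::metric_space) \<Rightarrow> 'a measure \<Rightarrow> ennreal" where
  "lower_slow_entropy L T \<mu> = (\<integral>\<^sup>+ x. lower_slow_entropy_at L T \<mu> x \<partial>\<mu>)"

definition borel_prob_measures :: "'a::topological_space measure set" where
  "borel_prob_measures = {\<mu>. prob_space \<mu> \<and> sets \<mu> = sets borel}"

end

theory Submission
  imports Defs
begin

text \<open>
  Both inequalities compare the size of a measure on Bowen balls with the cost of covering \<open>K\<close> by
  Bowen balls.

  The entropy of a measure is at most the topological entropy by the mass distribution principle
  (\<open>mass_distribution\<close>, \<open>lower_slow_entropy_le_top\<close>). If \<open>\<mu>\<close> has local entropy above \<open>s\<close> on a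
  set of positive measure, then on a smaller set \<open>A\<close> of positive measure all balls of time \<open>n \<ge> N\<close>
  and one fixed radius centred in \<open>A\<close> have measure at most \<open>\<lambda>\<^sub>n\<close> to the power \<open>-s\<close>. A cover
  of \<open>K\<close> by balls of half that radius and times at least \<open>N\<close> therefore costs at least \<open>\<mu> A\<close>.

  For the converse one needs a Frostman measure: if \<open>s < s'\<close> and covers of \<open>K\<close> of exponent \<open>s'\<close>
  have cost bounded below, there is a probability measure on \<open>K\<close> that gives every Bowen ball of
  time \<open>n\<close> at most a constant times \<open>\<lambda>\<^sub>n\<close> to the power \<open>-s\<close>. It suffices to control the dyadic
  times \<open>n = 2 ^ k\<close>, because \<open>\<lambda>\<^bsub>2n\<^esub>\<close> is at most a constant times \<open>\<lambda>\<^sub>n\<close>. This restriction is what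
  makes the argument work for slow entropy: \<open>\<lambda>\<^sub>n\<close> grows only polynomially, but the powers of
  \<open>\<lambda>\<^sub>n\<close> with a negative exponent are summable along dyadic times. The measure is built in three steps.

  \<^item> For finitely many times, replace \<open>K\<close> by a finite net. Linear programming duality, up to a factor
    of 3, gives weights on the net that obey the ball bounds, provided that fractional covers of the
    net cost enough (\<open>fractional_cover_dual_weights\<close>).
  \<^item> A fractional cover can be turned into a cover with three times the radius and the exponent
    \<open>s'\<close> in place of \<open>s\<close>, at the price of a constant. Each point of the net receives a definite share of its
    weight at some time \<open>2 ^ k\<close>, and a maximal separated set of the points that are heavy at that
    time is not too large (\<open>separated_net_of_heavy_points\<close>, \<open>slow_cover_sum_le_fractional_cover\<close>).
  \<^item> As the range of times grows, a subsequence of the measures converges weakly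
    (\<open>compact_prob_measures_weak_limit\<close>), and the bounds pass to the limit (\<open>frostman_measure\<close>).
\<close>

section \<open>Limits, integrals and countable covers\<close>

lemma Lim_at_right_antimono_eq_SUP:
  fixes f :: "real \<Rightarrow> ennreal"
  assumes anti: "\<And>x y. 0 < x \<Longrightarrow> x \<le> y \<Longrightarrow> f y \<le> f x"
  shows "Lim (at_right 0) f = (SUP x\<in>{0<..}. f x)"
proof (rule tendsto_Lim)
  show "(f \<longlongrightarrow> (SUP x\<in>{0<..}. f x)) (at_right 0)"
  proof (rule order_tendstoI)
    fix a assume "a < (SUP x\<in>{0<..}. f x)"
    then obtain x where x: "0 < x" "a < f x" by (auto simp: less_SUP_iff)
    have "a < f y" if "0 < y" "y < x" for y
      using anti[of y x] that x by (meson less_imp_le less_le_trans)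
    then show "eventually (\<lambda>y. a < f y) (at_right 0)"
      using x by (auto simp: eventually_at_right[of 0 1] intro!: eventually_at_rightI[of 0 x])
  next
    fix a assume a: "(SUP x\<in>{0<..}. f x) < a"
    have "f y < a" if "0 < y" for y
      using a that by (meson SUP_upper greaterThan_iff le_less_trans)
    then show "eventually (\<lambda>y. f y < a) (at_right 0)"
      by (auto intro!: eventually_at_rightI[of 0 1])
  qed
qed simp

text \<open>
  The integrand may be non-measurable: \<open>nn_integral\<close> is a supremum over simple functions below it,
  and a level set of such a simple function serves as \<open>A\<close>. It is applied to the local
  entropy, whose measurability is not clear.
\<close>
lemma nn_integral_gt_imp_pos_measure:
  fixes f :: "'a \<Rightarrow> ennreal"
  assumes "prob_space M" and gt: "s < (\<integral>\<^sup>+x. f x \<partial>M)"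
  obtains A where "A \<in> sets M" "0 < emeasure M A" "\<And>x. x \<in> A \<Longrightarrow> s < f x"
proof -
  interpret prob_space M by fact
  from gt obtain g where g: "simple_function M g" "g \<le> f" "s < integral\<^sup>S M g"
    unfolding nn_integral_def by (auto simp: less_SUP_iff)
  define A where "A = {x \<in> space M. s < g x}"
  have gm[measurable]: "g \<in> borel_measurable M"
    using g(1) by (rule borel_measurable_simple_function)
  have A: "A \<in> sets M" unfolding A_def by measurable
  have "emeasure M A \<noteq> 0"
  proof
    assume "emeasure M A = 0"
    then have "AE x in M. x \<notin> A" using A by (intro AE_not_in null_setsI)
    then have "AE x in M. g x \<le> s" using AE_space by eventually_elim (auto simp: A_def not_less)
    then have "(\<integral>\<^sup>+x. g x \<partial>M) \<le> (\<integral>\<^sup>+x. s \<partial>M)" by (rule nn_integral_mono_AE)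
    also have "\<dots> = s" by (simp add: emeasure_space_1)
    finally show False
      using g nn_integral_eq_simple_integral[OF g(1)] by (metis not_le)
  qed
  then show ?thesis
    using A g(2) by (intro that[of A]) (auto simp: A_def le_fun_def zero_less_iff_neq_zero intro: less_le_trans)
qed

lemma emeasure_UN_le_infsum:
  fixes I :: "nat set" and b :: "nat \<Rightarrow> ennreal"
  assumes A: "A \<in> sets M" and X: "\<And>i. i \<in> I \<Longrightarrow> X i \<in> sets M"
    and sub: "A \<subseteq> (\<Union>i\<in>I. X i)" and le: "\<And>i. i \<in> I \<Longrightarrow> emeasure M (X i) \<le> b i"
  shows "emeasure M A \<le> (\<Sum>\<^sub>\<infinity>i\<in>I. b i)"
proof -
  define Y where "Y i = (if i \<in> I then X i else {})" for i
  have Y: "range Y \<subseteq> sets M" using X by (auto simp: Y_def)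
  have "emeasure M A \<le> emeasure M (\<Union>i. Y i)"
    using sub Y by (intro emeasure_mono sets.countable_UN) (auto simp: Y_def split: if_splits)
  also have "\<dots> \<le> (\<Sum>i. emeasure M (Y i))"
    by (rule emeasure_subadditive_countably[OF Y])
  also have "\<dots> \<le> (\<Sum>\<^sub>\<infinity>i\<in>I. b i)"
  proof (subst suminf_eq_SUP, rule SUP_least)
    fix n
    have "(\<Sum>i<n. emeasure M (Y i)) = (\<Sum>\<^sub>\<infinity>i\<in>{..<n}. emeasure M (Y i))" by simp
    also have "\<dots> \<le> (\<Sum>\<^sub>\<infinity>i\<in>I. b i)"
      by (rule infsum_mono_neutral) (auto simp: Y_def le nonneg_summable_on_complete)
    finally show "(\<Sum>i<n. emeasure M (Y i)) \<le> (\<Sum>\<^sub>\<infinity>i\<in>I. b i)" .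
  qed
  finally show ?thesis .
qed

section \<open>Weak limits on a compact set\<close>

text \<open>
  Enumerate countably many balls of which, for every radius \<open>1 / (j + 1)\<close>, finitely many cover \<open>K\<close>.
  The code of a point is the ternary expansion with digits 0 and 1 that records the balls containing
  it. Points with close codes agree on the first digits, so they share a small ball.
\<close>
lemma compact_separating_code:
  fixes K :: "'a::metric_space set"
  assumes K: "compact K"
  obtains \<phi> :: "'a \<Rightarrow> real" where "\<phi> \<in> borel_measurable borel" "\<And>x. 0 \<le> \<phi> x" "\<And>x. \<phi> x \<le> 2"
    "\<And>\<epsilon>. 0 < \<epsilon> \<Longrightarrow> \<exists>\<delta>>0. \<forall>x\<in>K. \<forall>y\<in>K. \<bar>\<phi> x - \<phi> y\<bar> < \<delta> \<longrightarrow> dist x y < \<epsilon>"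
proof -
  have "\<exists>(c :: nat \<Rightarrow> 'a) m. K \<subseteq> (\<Union>i<m. ball (c i) (1 / real (Suc j)))" for j
  proof -
    obtain C where C: "C \<subseteq> K" "finite C" "K \<subseteq> (\<Union>x\<in>C. ball x (1 / real (Suc j)))"
      by (rule compactE_image[OF K, of K "\<lambda>x. ball x (1 / real (Suc j))"])
         (auto intro!: bexI)
    obtain c :: "nat \<Rightarrow> 'a" and m where c: "C = c ` {..<m}"
      using finite_imp_nat_seg_image_inj_on[OF C(2)] by (auto simp: lessThan_def)
    have "K \<subseteq> (\<Union>i<m. ball (c i) (1 / real (Suc j)))" using C(3) unfolding c by simp
    then show ?thesis by (intro exI)
  qed
  then have "\<forall>j. \<exists>(c :: nat \<Rightarrow> 'a) m. K \<subseteq> (\<Union>i<m. ball (c i) (1 / real (Suc j)))" by (rule allI)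
  from choice[OF this] obtain c :: "nat \<Rightarrow> nat \<Rightarrow> 'a" where "\<forall>j. \<exists>m. K \<subseteq> (\<Union>i<m. ball (c j i) (1 / real (Suc j)))" ..
  from choice[OF this] obtain m where cov: "\<And>j. K \<subseteq> (\<Union>i<(m j). ball (c j i) (1 / real (Suc j)))" by auto
  define U where "U n = (case prod_decode n of (j, i) \<Rightarrow> ball (c j i) (1 / real (Suc j)))" for n
  define \<phi> where "\<phi> x = (\<Sum>n. indicat_real (U n) x * (1/3)^n)" for x
  have sm0: "summable (\<lambda>n. (1/3::real)^n)" by (simp add: summable_geometric)
  have sm: "summable (\<lambda>n. indicat_real (U n) x * (1/3)^n)" for x
    by (rule summable_comparison_test'[OF sm0, of 0]) (auto simp: indicator_def)
  have far: "(1/3)^N / 2 \<le> \<bar>\<phi> x - \<phi> y\<bar>" if d: "indicat_real (U n) x \<noteq> indicat_real (U n) y" and "n \<le> N" for x y n N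
  proof -
    define d where "d n = (indicat_real (U n) x - indicat_real (U n) y) * (1/3)^n" for n
    define n0 where "n0 = (LEAST n. indicat_real (U n) x \<noteq> indicat_real (U n) y)"
    have n0: "indicat_real (U n0) x \<noteq> indicat_real (U n0) y" "n0 \<le> n"
      unfolding n0_def by (rule LeastI[of _ n], rule d) (rule Least_le[of _ n], rule d)
    have low: "d k = 0" if "k < n0" for k
      using not_less_Least[OF that[unfolded n0_def]] by (simp add: d_def)
    have sd: "summable d" 
      unfolding d_def left_diff_distrib by (intro summable_diff sm)
    have bd: "\<bar>d k\<bar> \<le> (1/3)^k" for k by (auto simp: d_def indicator_def)
    have "\<phi> x - \<phi> y = (\<Sum>k. d k)"
      unfolding \<phi>_def d_def left_diff_distrib by (rule suminf_diff[OF sm sm])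
    also have "\<dots> = (\<Sum>k. d (k + Suc n0)) + (\<Sum>k<Suc n0. d k)"
      by (rule suminf_split_initial_segment[OF sd])
    also have "(\<Sum>k<Suc n0. d k) = d n0" using low by simp
    finally have eq: "\<phi> x - \<phi> y = (\<Sum>k. d (k + Suc n0)) + d n0" .
    have s1: "summable (\<lambda>k. (1/3::real)^(k + Suc n0))"
      using summable_ignore_initial_segment[OF sm0] .
    have "\<bar>\<Sum>k. d (k + Suc n0)\<bar> \<le> (\<Sum>k. (1/3)^(k + Suc n0))"
      using norm_suminf_le[of "\<lambda>k. d (k + Suc n0)", OF _ s1] bd unfolding real_norm_def by blast
    also have "\<dots> = (\<Sum>k. (1/3)^k * (1/3)^Suc n0)" by (simp add: power_add)
    also have "\<dots> = (\<Sum>k. (1/3)^k) * (1/3)^Suc n0" by (rule suminf_mult2[symmetric, OF sm0])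
    also have "\<dots> = (1/3)^n0 / 2" by (simp add: suminf_geometric)
    finally have t: "\<bar>\<Sum>k. d (k + Suc n0)\<bar> \<le> (1/3)^n0 / 2" .
    have "\<bar>d n0\<bar> = (1/3)^n0" using n0(1) by (auto simp: d_def indicator_def split: if_splits)
    then have "(1/3)^n0 / 2 \<le> \<bar>\<phi> x - \<phi> y\<bar>" using t eq by linarith
    moreover have "(1/3::real)^N \<le> (1/3)^n0" using n0(2) \<open>n \<le> N\<close> by (intro power_decreasing) auto
    ultimately show ?thesis by linarith
  qed
  show ?thesis
  proof (rule that)
    have [measurable]: "U n \<in> sets borel" for n by (auto simp: U_def split: prod.split)
    show "\<phi> \<in> borel_measurable borel" unfolding \<phi>_def by measurable
    show "0 \<le> \<phi> x" for x unfolding \<phi>_def by (intro suminf_nonneg sm) simp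
    show "\<phi> x \<le> 2" for x
    proof -
      have "\<phi> x \<le> (\<Sum>n. (1/3::real)^n)"
        unfolding \<phi>_def by (intro suminf_le sm sm0) (simp add: indicator_def)
      then show ?thesis by (simp add: suminf_geometric)
    qed
    fix \<epsilon> :: real assume "0 < \<epsilon>"
    then obtain j where j: "2 / real (Suc j) < \<epsilon>"
      using reals_Archimedean[of "\<epsilon>/2"] by (auto simp: field_simps)
    \<comment> \<open>Points that agree up to index \<open>N\<close> lie in the same members of the finite cover of radius \<open>1 / (j + 1)\<close>.\<close>
    define N where "N = Max (insert 0 ((\<lambda>i. prod_encode (j, i)) ` {..<m j}))"
    have N: "prod_encode (j, i) \<le> N" if "i < m j" for i
      unfolding N_def using that by (intro Max_ge) auto
    have "dist x y < \<epsilon>" if xy: "x \<in> K" "y \<in> K" "\<bar>\<phi> x - \<phi> y\<bar> < (1/3)^N / 2" for x y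
    proof -
      obtain i where i: "i < m j" "x \<in> ball (c j i) (1 / real (Suc j))" using cov xy(1) by blast
      have "U (prod_encode (j, i)) = ball (c j i) (1 / real (Suc j))" by (simp add: U_def)
      moreover have "indicat_real (U (prod_encode (j, i))) x = indicat_real (U (prod_encode (j, i))) y"
        using far[OF _ N[OF i(1)]] xy(3) by fastforce
      ultimately have "y \<in> ball (c j i) (1 / real (Suc j))"
        using i(2) by (auto simp: indicator_def split: if_splits)
      then have "dist x y < 1 / real (Suc j) + 1 / real (Suc j)"
        using i(2) by (intro dist_triangle_less_add[of x "c j i" _ y]) (auto simp: dist_commute)
      then show ?thesis using j by linarith
    qed
    then show "\<exists>\<delta>>0. \<forall>x\<in>K. \<forall>y\<in>K. \<bar>\<phi> x - \<phi> y\<bar> < \<delta> \<longrightarrow> dist x y < \<epsilon>"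
      by (intro exI[of _ "(1/3)^N / 2"]) auto
  qed
qed

text \<open>
  A substitute for the theorem that every compact metric space is a continuous image of a closed
  subset of the Cantor set: the inverse of the code is uniformly continuous, so it extends to the
  closure of the set of codes. The relation \<open>P t z\<close> in the proof says that \<open>z\<close> is a limit of points
  whose codes tend to \<open>t\<close>.
\<close>
lemma compact_image_of_real_closed:
  fixes K :: "'a::metric_space set"
  assumes K: "compact K"
  obtains \<phi> :: "'a \<Rightarrow> real" and g :: "real \<Rightarrow> 'a"
  where "\<phi> \<in> borel_measurable borel" "\<And>x. 0 \<le> \<phi> x" "\<And>x. \<phi> x \<le> 2"
    "continuous_on (closure (\<phi> ` K)) g" "g ` closure (\<phi> ` K) \<subseteq> K" "\<And>x. x \<in> K \<Longrightarrow> g (\<phi> x) = x"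
proof -
  obtain \<phi> :: "'a \<Rightarrow> real" where \<phi>: "\<phi> \<in> borel_measurable borel" "\<And>x. 0 \<le> \<phi> x" "\<And>x. \<phi> x \<le> 2"
    "\<And>\<epsilon>. 0 < \<epsilon> \<Longrightarrow> \<exists>\<delta>>0. \<forall>x\<in>K. \<forall>y\<in>K. \<bar>\<phi> x - \<phi> y\<bar> < \<delta> \<longrightarrow> dist x y < \<epsilon>"
    using compact_separating_code[OF K] by blast
  define P where "P t z \<longleftrightarrow> z \<in> K \<and> (\<forall>\<eta>>0. \<exists>x\<in>K. \<bar>\<phi> x - t\<bar> < \<eta> \<and> dist x z < \<eta>)" for t z
  have ex: "\<exists>z. P t z" if t: "t \<in> closure (\<phi> ` K)" for t
  proof -
    obtain y where y: "\<And>n. y n \<in> \<phi> ` K" "y \<longlonglongrightarrow> t" using t closure_sequential by blast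
    then have "\<forall>n. \<exists>x. x \<in> K \<and> y n = \<phi> x" by blast
    from choice[OF this] obtain x where x: "\<And>n. x n \<in> K" "\<And>n. y n = \<phi> (x n)" by blast
    obtain z r where z: "z \<in> K" "strict_mono (r :: nat \<Rightarrow> nat)" "(x \<circ> r) \<longlonglongrightarrow> z"
      using K x(1) unfolding compact_def by metis
    have "\<exists>x\<in>K. \<bar>\<phi> x - t\<bar> < \<eta> \<and> dist x z < \<eta>" if "0 < \<eta>" for \<eta>
    proof -
      have "(y \<circ> r) \<longlonglongrightarrow> t" using y(2) z(2) by (rule LIMSEQ_subseq_LIMSEQ)
      then have "eventually (\<lambda>n. dist ((y \<circ> r) n) t < \<eta>) sequentially" using that by (rule tendstoD)
      moreover have "eventually (\<lambda>n. dist ((x \<circ> r) n) z < \<eta>) sequentially" using z(3) that by (rule tendstoD)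
      ultimately have "eventually (\<lambda>n. dist ((y \<circ> r) n) t < \<eta> \<and> dist ((x \<circ> r) n) z < \<eta>) sequentially"
        by (rule eventually_conj)
      then obtain n where "dist ((y \<circ> r) n) t < \<eta>" "dist ((x \<circ> r) n) z < \<eta>"
        by (auto simp: eventually_sequentially)
      then show ?thesis using x by (intro bexI[of _ "x (r n)"]) (auto simp: dist_real_def)
    qed
    then show ?thesis using z(1) by (auto simp: P_def)
  qed
  have uc: "\<exists>\<delta>>0. \<forall>t t' z z'. P t z \<longrightarrow> P t' z' \<longrightarrow> \<bar>t - t'\<bar> < \<delta> \<longrightarrow> dist z z' < \<epsilon>" if e: "0 < \<epsilon>" for \<epsilon>
  proof -
    obtain \<delta> where \<delta>: "\<delta> > 0" "\<And>x y. x \<in> K \<Longrightarrow> y \<in> K \<Longrightarrow> \<bar>\<phi> x - \<phi> y\<bar> < \<delta> \<Longrightarrow> dist x y < \<epsilon>/3"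
      using \<phi>(4)[of "\<epsilon>/3"] e by auto
    have "dist z z' < \<epsilon>" if p: "P t z" "P t' z'" "\<bar>t - t'\<bar> < \<delta>/3" for t t' z z'
    proof -
      define \<eta> where "\<eta> = min (\<delta>/3) (\<epsilon>/3)"
      have "\<eta> > 0" using \<delta> e by (simp add: \<eta>_def)
      then obtain x x' where x: "x \<in> K" "\<bar>\<phi> x - t\<bar> < \<eta>" "dist x z < \<eta>"
          "x' \<in> K" "\<bar>\<phi> x' - t'\<bar> < \<eta>" "dist x' z' < \<eta>"
        using p(1,2) unfolding P_def by meson
      have "\<bar>\<phi> x - \<phi> x'\<bar> < \<delta>" using x p(3) unfolding \<eta>_def by linarith
      then have "dist x x' < \<epsilon>/3" using \<delta>(2) x by blast
      moreover have "dist z z' \<le> dist x z + dist x x' + dist x' z'"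
        using dist_triangle[of z z' x] dist_triangle[of x z' x'] by (simp add: dist_commute)
      ultimately show ?thesis using x unfolding \<eta>_def by linarith
    qed
    then show ?thesis using \<delta>(1) by (intro exI[of _ "\<delta>/3"]) auto
  qed
  have uniq: "z = z'" if "P t z" "P t z'" for t z z'
  proof (rule ccontr)
    assume "z \<noteq> z'"
    then obtain \<delta> where "\<delta> > 0" "\<And>t t' w w'. P t w \<Longrightarrow> P t' w' \<Longrightarrow> \<bar>t - t'\<bar> < \<delta> \<Longrightarrow> dist w w' < dist z z'"
      using uc[of "dist z z'"] by (metis zero_less_dist_iff)
    from this(2)[OF that] this(1) show False by simp
  qed
  define g where "g t = (SOME z. P t z)" for t
  have g: "P t (g t)" if "t \<in> closure (\<phi> ` K)" for t
    unfolding g_def using ex[OF that] by (rule someI_ex)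
  show ?thesis
  proof (rule that[OF \<phi>(1-3)])
    show "continuous_on (closure (\<phi> ` K)) g"
      unfolding continuous_on_iff
    proof safe
      fix t and \<epsilon> :: real assume t: "t \<in> closure (\<phi> ` K)" "0 < \<epsilon>"
      obtain \<delta> where "\<delta> > 0" "\<And>t t' w w'. P t w \<Longrightarrow> P t' w' \<Longrightarrow> \<bar>t - t'\<bar> < \<delta> \<Longrightarrow> dist w w' < \<epsilon>"
        using uc[OF t(2)] by auto
      moreover have "dist (g t') (g t) < \<epsilon>" if "t' \<in> closure (\<phi> ` K)" "dist t' t < \<delta>" for t'
        using calculation(2)[OF g[OF that(1)] g[OF t(1)]] that(2) by (simp add: dist_real_def)
      ultimately show "\<exists>d>0. \<forall>x'\<in>closure (\<phi> ` K). dist x' t < d \<longrightarrow> dist (g x') (g t) < \<epsilon>"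
        by blast
    qed
    show "g ` closure (\<phi> ` K) \<subseteq> K" using g by (auto simp: P_def)
    show "g (\<phi> x) = x" if "x \<in> K" for x
    proof (rule uniq)
      show "P (\<phi> x) (g (\<phi> x))" using that by (intro g) (auto intro: closure_subset[THEN subsetD])
      show "P (\<phi> x) x" using that by (auto simp: P_def intro!: bexI[of _ x])
    qed
  qed
qed


text \<open>
  The codes transport the measures to a bounded interval, where Helly's theorem
  provides a convergent subsequence; the limit is carried back by the continuous inverse \<open>g\<close>. A test
  function on \<open>K\<close> becomes, after composition with \<open>g\<close>, a function on the closed set \<open>E\<close> of codes, which
  extends to the line by Tietze's theorem. So the limit must be concentrated on \<open>E\<close>.
\<close>
lemma compact_prob_measures_weak_limit:
  fixes K :: "'a::metric_space set" and M :: "nat \<Rightarrow> 'a measure"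
  assumes K: "compact K"
    and M: "\<And>n. prob_space (M n)" "\<And>n. sets (M n) = sets borel" "\<And>n. emeasure (M n) K = 1"
  obtains r \<mu> where "strict_mono (r :: nat \<Rightarrow> nat)" "prob_space \<mu>" "sets \<mu> = sets borel" "measure \<mu> K = 1"
    "\<And>f :: 'a \<Rightarrow> real. continuous_on UNIV f \<Longrightarrow> (\<lambda>n. \<integral>x. f x \<partial>M (r n)) \<longlonglongrightarrow> (\<integral>x. f x \<partial>\<mu>)"
proof -
  obtain \<phi> :: "'a \<Rightarrow> real" and g :: "real \<Rightarrow> 'a" where
    \<phi>: "\<phi> \<in> borel_measurable borel" "\<And>x. 0 \<le> \<phi> x" "\<And>x. \<phi> x \<le> 2" and
    g: "continuous_on (closure (\<phi> ` K)) g" "g ` closure (\<phi> ` K) \<subseteq> K" "\<And>x. x \<in> K \<Longrightarrow> g (\<phi> x) = x"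
    using compact_image_of_real_closed[OF K] by blast
  define E where "E = closure (\<phi> ` K)"
  have clE: "closed E" by (simp add: E_def)
  have \<phi>E: "\<phi> x \<in> E" if "x \<in> K" for x
    using that closure_subset[of "\<phi> ` K"] by (auto simp: E_def)
  have Kb: "K \<in> sets borel" using K by (simp add: compact_imp_closed)
  have "K \<noteq> {}" using M(3)[of 0] by auto
  then obtain z where z: "z \<in> K" by blast
  have M\<phi>[measurable]: "\<phi> \<in> borel_measurable (M n)" for n
    using \<phi>(1) measurable_cong_sets[OF M(2)[of n] refl] by blast
  have AEK: "AE x in M n. x \<in> K" for n
  proof -
    interpret prob_space "M n" by (rule M(1))
    show ?thesis using M(3)[of n] Kb M(2)[of n] AE_in_set_eq_1[of K] by (simp add: measure_def)
  qed
  define \<nu> where "\<nu> n = distr (M n) borel \<phi>" for n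
  have rd: "real_distribution (\<nu> n)" for n
    unfolding \<nu>_def by (intro prob_space.real_distribution_distr M(1) M\<phi>)
  have "tight \<nu>"
    unfolding tight_def
  proof (intro conjI allI impI rd)
    fix \<epsilon> :: real assume e: "0 < \<epsilon>"
    have "measure (\<nu> n) {-1<..2} = 1" for n
    proof -
      interpret prob_space "M n" by (rule M(1))
      have "-1 < \<phi> x" for x using \<phi>(2)[of x] by linarith
      then have "\<phi> -` {-1<..2} \<inter> space (M n) = space (M n)"
        using \<phi>(3) by auto
      then show ?thesis unfolding \<nu>_def by (subst measure_distr) (auto simp: prob_space)
    qed
    then show "\<exists>a b. a < b \<and> (\<forall>n. 1 - \<epsilon> < measure (\<nu> n) {a<..b})"
      using e by (intro exI[of _ "-1"] exI[of _ 2]) auto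
  qed
  then obtain r \<nu>' where r: "strict_mono (r :: nat \<Rightarrow> nat)" and \<nu>': "real_distribution \<nu>'"
    and conv: "weak_conv_m (\<nu> \<circ> r) \<nu>'"
    using tight_imp_convergent_subsubsequence[of \<nu> id] strict_mono_id by auto
  interpret \<nu>': real_distribution \<nu>' by fact
  have lim: "(\<lambda>n. \<integral>x. F (\<phi> x) \<partial>M (r n)) \<longlonglongrightarrow> (\<integral>t. F t \<partial>\<nu>')"
    if F: "continuous_on UNIV F" "\<And>t. \<bar>F t\<bar> \<le> B" for F :: "real \<Rightarrow> real" and B
  proof -
    have "(\<lambda>n. \<integral>t. F t \<partial>((\<nu> \<circ> r) n)) \<longlonglongrightarrow> (\<integral>t. F t \<partial>\<nu>')"
      by (rule weak_conv_imp_integral_bdd_continuous_conv[OF _ \<nu>' conv, of F B])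
        (use rd F in \<open>auto simp: continuous_on_eq_continuous_at\<close>)
    moreover have "(\<integral>t. F t \<partial>((\<nu> \<circ> r) n)) = (\<integral>x. F (\<phi> x) \<partial>M (r n))" for n
      unfolding \<nu>_def comp_def
      using F(1) by (intro integral_distr) (auto intro: borel_measurable_continuous_onI)
    ultimately show ?thesis by simp
  qed
  have AEE: "AE t in \<nu>'. t \<in> E"
  proof -
    define F where "F t = min 1 (infdist t E)" for t :: real
    have F: "continuous_on UNIV F" "\<And>t. \<bar>F t\<bar> \<le> 1"
      unfolding F_def using infdist_nonneg[of _ E]
      by (auto intro!: continuous_on_min continuous_on_infdist continuous_intros simp: abs_if not_less intro: order_trans[of _ 0])
    have Fm[measurable]: "F \<in> borel_measurable borel" using F(1) by (rule borel_measurable_continuous_onI)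
    have "(\<integral>x. F (\<phi> x) \<partial>M (r n)) = 0" for n
    proof -
      have "AE x in M (r n). F (\<phi> x) = 0" using AEK by eventually_elim (simp add: F_def \<phi>E)
      then show ?thesis by (rule integral_eq_zero_AE)
    qed
    then have "(\<integral>t. F t \<partial>\<nu>') = 0" using LIMSEQ_unique[OF lim[OF F]] by simp
    moreover have "integrable \<nu>' F" using F(2) by (intro \<nu>'.integrable_const_bound[of _ 1]) auto
    ultimately have "AE t in \<nu>'. F t = 0"
      by (subst (asm) integral_nonneg_eq_0_iff_AE) (auto simp: F_def infdist_nonneg)
    then show ?thesis
    proof eventually_elim
      case (elim t)
      then have "infdist t E = 0" by (auto simp: F_def min_def split: if_splits)
      then show ?case using clE \<phi>E[OF z] in_closed_iff_infdist_zero[of E t] by blast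
    qed
  qed
  define G where "G t = (if t \<in> E then g t else z)" for t
  have Gm[measurable]: "G \<in> borel_measurable borel"
    unfolding G_def using clE g(1) by (intro borel_measurable_continuous_on_if) (auto simp: E_def)
  have GK: "G t \<in> K" for t using g(2) z by (auto simp: G_def E_def)
  define \<mu> where "\<mu> = distr \<nu>' borel G"
  show ?thesis
  proof (rule that[OF r])
    show "prob_space \<mu>" unfolding \<mu>_def by (rule \<nu>'.prob_space_distr) simp
    show "sets \<mu> = sets borel" by (simp add: \<mu>_def)
    have "G -` K \<inter> space \<nu>' = space \<nu>'" using GK by auto
    then show "measure \<mu> K = 1"
      unfolding \<mu>_def using Kb \<nu>'.prob_space by (subst measure_distr) auto
    fix f :: "'a \<Rightarrow> real" assume f: "continuous_on UNIV f"
    have "compact (f ` K)" using K f by (metis compact_continuous_image continuous_on_subset subset_UNIV)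
    then obtain B where B: "\<And>x. x \<in> K \<Longrightarrow> \<bar>f x\<bar> \<le> B"
      using compact_imp_bounded[of "f ` K"] by (auto simp: bounded_iff)
    have "0 \<le> B" using B[OF z] by linarith
    have "continuous_on E (f \<circ> g)"
      using g(1) f unfolding E_def by (metis continuous_on_compose continuous_on_subset subset_UNIV)
    moreover have "norm ((f \<circ> g) t) \<le> B" if "t \<in> E" for t
      using g(2) B that by (auto simp: E_def)
    moreover have "closedin (top_of_set UNIV) E" using clE by simp
    ultimately obtain F where F: "continuous_on UNIV F" "\<And>t. t \<in> E \<Longrightarrow> F t = (f \<circ> g) t" "\<And>t. norm (F t) \<le> B"
      using Tietze[of E "f \<circ> g" UNIV B] \<open>0 \<le> B\<close> by (metis UNIV_I)
    have Fm[measurable]: "F \<in> borel_measurable borel" using F(1) by (rule borel_measurable_continuous_onI)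
    have fm[measurable]: "f \<in> borel_measurable borel" using f by (rule borel_measurable_continuous_onI)
    have "(\<integral>x. F (\<phi> x) \<partial>M (r n)) = (\<integral>x. f x \<partial>M (r n))" for n
    proof (rule integral_cong_AE)
      show "f \<in> borel_measurable (M (r n))"
        using fm measurable_cong_sets[OF M(2) refl] by blast
      show "AE x in M (r n). F (\<phi> x) = f x"
        using AEK by eventually_elim (simp add: F(2) \<phi>E g(3))
    qed measurable
    moreover have "(\<integral>t. F t \<partial>\<nu>') = (\<integral>x. f x \<partial>\<mu>)"
    proof -
      have "(\<integral>x. f x \<partial>\<mu>) = (\<integral>t. f (G t) \<partial>\<nu>')"
        unfolding \<mu>_def by (rule integral_distr) measurable
      also have "\<dots> = (\<integral>t. F t \<partial>\<nu>')"
      proof (rule integral_cong_AE)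
        show "AE t in \<nu>'. f (G t) = F t" using AEE by eventually_elim (simp add: F(2) G_def)
      qed measurable
      finally show ?thesis by simp
    qed
    ultimately show "(\<lambda>n. \<integral>x. f x \<partial>M (r n)) \<longlonglongrightarrow> (\<integral>x. f x \<partial>\<mu>)"
      using lim[of F B] F by simp
  qed
qed

section \<open>Duality for fractional covers\<close>

text \<open>
  The simplex is compact in the product topology on functions, since the weights vanish outside of
  a finite set.
\<close>
lemma simplex_argmin:
  fixes \<Phi> :: "('a \<Rightarrow> real) \<Rightarrow> real"
  assumes F: "finite F" "F \<noteq> {}" and cont: "continuous_on UNIV \<Phi>"
  obtains w where "\<And>x. 0 \<le> w x" "\<And>x. x \<notin> F \<Longrightarrow> w x = 0" "sum w F = 1"
    "\<And>v. (\<And>x. 0 \<le> v x) \<Longrightarrow> (\<And>x. x \<notin> F \<Longrightarrow> v x = 0) \<Longrightarrow> sum v F = 1 \<Longrightarrow> \<Phi> w \<le> \<Phi> v"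
proof -
  define S where "S = PiE UNIV (\<lambda>x. if x \<in> F then {0..1::real} else {0}) \<inter> {w. sum w F = 1}"
  have S: "w \<in> S \<longleftrightarrow> (\<forall>x. 0 \<le> w x) \<and> (\<forall>x. x \<notin> F \<longrightarrow> w x = 0) \<and> sum w F = 1" for w
  proof -
    have "w x \<le> 1" if "\<forall>x. 0 \<le> w x" "sum w F = 1" "x \<in> F" for x
      using member_le_sum[OF that(3), of w] that F(1) by auto
    then show ?thesis by (fastforce simp: S_def PiE_iff split: if_splits)
  qed
  have "compact (PiE UNIV (\<lambda>x. if x \<in> F then {0..1::real} else {0}))"
    unfolding compactin_euclidean_iff[symmetric] euclidean_product_topology[symmetric] compactin_PiE
    by auto
  moreover have "closed {w :: 'a \<Rightarrow> real. sum w F = 1}"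
    by (intro closed_Collect_eq continuous_on_sum continuous_on_const) simp
  ultimately have "compact S" unfolding S_def by (rule compact_Int_closed)
  moreover obtain x0 where x0: "x0 \<in> F" using F by blast
  then have "(\<lambda>x. if x = x0 then 1 else 0) \<in> S"
    using F(1) by (auto simp: S)
  ultimately obtain w where w: "w \<in> S" "\<forall>v\<in>S. \<Phi> w \<le> \<Phi> v"
    using continuous_attains_inf[of S \<Phi>] cont by (metis continuous_on_subset empty_iff subset_UNIV)
  show ?thesis
  proof (rule that[of w])
    show "\<Phi> w \<le> \<Phi> v" if "\<And>x. 0 \<le> v x" "\<And>x. x \<notin> F \<Longrightarrow> v x = 0" "sum v F = 1" for v
      using that w(2) S by blast
  qed (use w(1) S in auto)
qed

text \<open>
  This is linear programming duality up to the factor 3. Among all probability weights on \<open>F\<close>, take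
  a minimiser \<open>w\<close> of \<open>\<Phi>\<close>, the sum of the powers of order \<open>q + 1\<close> of the normalised masses
  \<open>A j = w (B j) / b j\<close>.
  Moving mass towards a point \<open>x\<close> cannot decrease \<open>\<Phi>\<close>, and this first-order condition says that
  the coefficients \<open>A j ^ q / (b j * \<Phi> w)\<close> form a fractional cover of \<open>F\<close>. Its cost is the quotient
  of a power sum of order \<open>q\<close> by one of order \<open>q + 1\<close>, hence at most \<open>3 / m\<close>, where \<open>m\<close> is the
  largest \<open>A j\<close>, as soon as \<open>2 ^ q\<close> exceeds the number of sets.
\<close>
lemma fractional_cover_dual_weights:
  fixes b :: "'j \<Rightarrow> real" and B :: "'j \<Rightarrow> 'a set"
  assumes F: "finite F" "F \<noteq> {}" and J: "finite J" and b: "\<And>j. j \<in> J \<Longrightarrow> 0 < b j" and W: "0 < W"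
    and cover: "\<And>c. (\<And>j. j \<in> J \<Longrightarrow> 0 \<le> c j) \<Longrightarrow> (\<And>x. x \<in> F \<Longrightarrow> 1 \<le> (\<Sum>j\<in>{j \<in> J. x \<in> B j}. c j)) \<Longrightarrow>
      W \<le> (\<Sum>j\<in>J. c j * b j)"
  obtains w where "\<And>x. 0 \<le> w x" "\<And>x. x \<notin> F \<Longrightarrow> w x = 0" "sum w F = 1"
    "\<And>j. j \<in> J \<Longrightarrow> sum w (F \<inter> B j) \<le> 3 / W * b j"
proof -
  obtain q where q: "card J < 2 ^ q" using less_exp by blast
  define a where "a j w = (\<Sum>x\<in>F \<inter> B j. w x) / b j" for j and w :: "'a \<Rightarrow> real"
  define \<Phi> where "\<Phi> w = (\<Sum>j\<in>J. a j w ^ Suc q)" for w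
  have "continuous_on UNIV \<Phi>"
    unfolding \<Phi>_def a_def using b
    by (intro continuous_on_sum continuous_on_power continuous_on_divide continuous_on_const) 
       (auto simp: less_imp_neq[THEN not_sym])
  then obtain w where w: "\<And>x. 0 \<le> w x" "\<And>x. x \<notin> F \<Longrightarrow> w x = 0" "sum w F = 1"
    and min: "\<And>v. (\<And>x. 0 \<le> v x) \<Longrightarrow> (\<And>x. x \<notin> F \<Longrightarrow> v x = 0) \<Longrightarrow> sum v F = 1 \<Longrightarrow> \<Phi> w \<le> \<Phi> v"
    using simplex_argmin[OF F] by metis
  define A where "A j = a j w" for j
  have A0: "0 \<le> A j" if "j \<in> J" for j
    unfolding A_def a_def using w(1) b[OF that] by (intro divide_nonneg_pos sum_nonneg) auto
  have first_order: "\<Phi> w \<le> (\<Sum>j\<in>{j \<in> J. x \<in> B j}. A j ^ q / b j)" if x: "x \<in> F" for x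
  proof -
    define e where "e j = (if x \<in> B j then 1 / b j else 0)" for j
    \<comment> \<open>\<open>v\<close> runs along the segment from \<open>w\<close> to the point mass at \<open>x\<close>.\<close>
    define v where "v t = (\<lambda>y. (1 - t) * w y + (if y = x then t else 0))" for t
    have av: "a j (v t) = A j + t * (e j - A j)" for j t
    proof -
      have "(\<Sum>y\<in>F \<inter> B j. v t y) = (1 - t) * (\<Sum>y\<in>F \<inter> B j. w y) + (if x \<in> B j then t else 0)"
        using x F(1) by (simp add: v_def sum.distrib sum_distrib_left)
      then have "a j (v t) = (1 - t) * A j + (if x \<in> B j then t else 0) / b j"
        by (simp add: a_def A_def add_divide_distrib)
      also have "(if x \<in> B j then t else 0) / b j = t * e j" by (simp add: e_def)
      finally show ?thesis by (simp add: algebra_simps)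
    qed
    have ge: "\<Phi> w \<le> \<Phi> (v t)" if "0 \<le> t" "t \<le> 1" for t
    proof (rule min)
      show "0 \<le> v t y" for y using that w(1) by (simp add: v_def)
      show "v t y = 0" if "y \<notin> F" for y using that x w(2) by (auto simp: v_def)
      show "sum (v t) F = 1"
        using x F(1) w(3) by (simp add: v_def sum.distrib sum_distrib_left[symmetric])
    qed
    have \<Phi>v: "\<Phi> (v t) = (\<Sum>j\<in>J. (A j + t * (e j - A j)) ^ Suc q)" for t
      by (simp add: \<Phi>_def av)
    have "((\<lambda>t. \<Phi> (v t)) has_real_derivative (\<Sum>j\<in>J. real (Suc q) * (A j ^ q * (e j - A j)))) (at 0)"
      unfolding \<Phi>v by (auto intro!: derivative_eq_intros sum.cong simp del: power_Suc)
    note deriv = DERIV_neg_dec_right[OF this]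
    have "0 \<le> (\<Sum>j\<in>J. real (Suc q) * (A j ^ q * (e j - A j)))"
    proof (rule ccontr)
      assume "\<not> ?thesis"
      then obtain d where d: "0 < d" "\<And>h. 0 < h \<Longrightarrow> h < d \<Longrightarrow> \<Phi> (v h) < \<Phi> (v 0)"
        using deriv by (auto simp: not_le)
      have "\<Phi> (v (min (d/2) 1)) < \<Phi> (v 0)" using d(1) by (intro d(2)) auto
      moreover have "v 0 = w" by (simp add: v_def)
      ultimately show False using ge[of "min (d/2) 1"] d(1) by simp
    qed
    then have "0 \<le> (\<Sum>j\<in>J. A j ^ q * (e j - A j))"
      by (simp add: sum_distrib_left[symmetric] zero_le_mult_iff)
    also have "\<dots> = (\<Sum>j\<in>J. A j ^ q * e j) - \<Phi> w"
      by (simp add: \<Phi>_def A_def right_diff_distrib sum_subtractf mult.commute)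
    also have "(\<Sum>j\<in>J. A j ^ q * e j) = (\<Sum>j\<in>{j \<in> J. x \<in> B j}. A j ^ q / b j)"
      using J by (intro sum.mono_neutral_cong_right) (auto simp: e_def)
    finally show ?thesis by simp
  qed
  have "A i \<le> 3 / W" if i: "i \<in> J" for i
  proof -
    define m where "m = Max (A ` J)"
    have m: "A j \<le> m" if "j \<in> J" for j using that J by (simp add: m_def)
    obtain j0 where j0: "j0 \<in> J" "A j0 = m"
      using Max_in[of "A ` J"] J i unfolding m_def by (metis empty_iff finite_imageI imageE image_is_empty)
    show ?thesis
    proof (cases "m > 0")
      case False
      then have "A i \<le> 0" using m[OF i] by simp
      also have "0 \<le> 3 / W" using W by simp
      finally show ?thesis .
    next
      case True
      have \<Phi>m: "m ^ Suc q \<le> \<Phi> w"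
        unfolding \<Phi>_def A_def[symmetric] j0(2)[symmetric]
        using j0(1) J A0 by (intro member_le_sum[of j0 J "\<lambda>j. A j ^ Suc q"]) auto
      then have \<Phi>0: "0 < \<Phi> w" using True by (meson less_le_trans zero_less_power)
      define c where "c j = A j ^ q / b j / \<Phi> w" for j
      have "W \<le> (\<Sum>j\<in>J. c j * b j)"
      proof (rule cover)
        show "0 \<le> c j" if "j \<in> J" for j using A0[OF that] b[OF that] \<Phi>0 by (simp add: c_def)
        show "1 \<le> (\<Sum>j\<in>{j \<in> J. x \<in> B j}. c j)" if "x \<in> F" for x
          using first_order[OF that] \<Phi>0 unfolding c_def sum_divide_distrib[symmetric]
          by (simp add: pos_le_divide_eq)
      qed
      also have "\<dots> = (\<Sum>j\<in>J. A j ^ q) / \<Phi> w"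
        unfolding sum_divide_distrib using b by (intro sum.cong) (auto simp: c_def less_imp_neq[THEN not_sym])
      \<comment> \<open>Distinguish whether \<open>A j\<close> is at most or above half of the maximum \<open>m\<close>.\<close>
      also have "(\<Sum>j\<in>J. A j ^ q) \<le> (\<Sum>j\<in>J. 2 / m * A j ^ Suc q + (m/2) ^ q)"
      proof (rule sum_mono)
        fix j assume j: "j \<in> J"
        show "A j ^ q \<le> 2 / m * A j ^ Suc q + (m/2) ^ q"
        proof (cases "A j \<le> m / 2")
          case le: True
          have "A j ^ q \<le> (m/2) ^ q" using le A0[OF j] by (rule power_mono)
          moreover have "0 \<le> 2 / m * A j ^ Suc q" using True A0[OF j] by simp
          ultimately show ?thesis by linarith
        next
          case False
          then have "1 \<le> 2 / m * A j" using True by (simp add: field_simps)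
          then have "1 * A j ^ q \<le> (2 / m * A j) * A j ^ q" using A0[OF j] by (intro mult_right_mono) auto
          moreover have "0 \<le> (m/2) ^ q" using True by simp
          ultimately show ?thesis by simp
        qed
      qed
      also have "\<dots> = 2 / m * \<Phi> w + real (card J) * (m/2) ^ q"
        by (simp add: \<Phi>_def A_def sum.distrib sum_distrib_left)
      also have "real (card J) * (m/2) ^ q \<le> m ^ q"
      proof -
        have "real (card J) \<le> 2 ^ q" using q by (metis less_imp_le of_nat_le_iff of_nat_numeral of_nat_power)
        then have "real (card J) * (m/2) ^ q \<le> 2 ^ q * (m/2) ^ q" using True by (intro mult_right_mono) auto
        then show ?thesis by (simp add: power_divide)
      qed
      also have "m ^ q \<le> \<Phi> w / m" using \<Phi>m True by (simp add: field_simps)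
      finally have "W \<le> (2 / m * \<Phi> w + \<Phi> w / m) / \<Phi> w" using \<Phi>0 by (simp add: divide_right_mono)
      also have "\<dots> = 3 / m" using \<Phi>0 by (simp add: field_simps)
      finally have "m \<le> 3 / W" using True W by (simp add: field_simps)
      then show ?thesis using m[OF i] by linarith
    qed
  qed
  then have "sum w (F \<inter> B j) \<le> 3 / W * b j" if "j \<in> J" for j
    using that b[OF that] unfolding A_def a_def by (metis pos_divide_le_eq)
  then show ?thesis using w that by blast
qed

text \<open>
  A maximal \<open>2\<epsilon>\<close>-separated set \<open>E\<close> of heavy points: the balls of radius \<open>\<epsilon>\<close> around its points are
  disjoint and each of them carries weight at least \<open>t\<close>, which bounds \<open>card E\<close>.
\<close>
lemma separated_net_of_heavy_points:
  fixes D :: "'a \<Rightarrow> 'a \<Rightarrow> real" and c :: "'a \<Rightarrow> real"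
  assumes F: "finite F"
    and D: "\<And>x y. D x y = D y x" "\<And>x y z. D x z \<le> D x y + D y z" "\<And>x. D x x = 0"
    and c: "\<And>x. x \<in> F \<Longrightarrow> 0 \<le> c x" and "0 < \<epsilon>"
  obtains E where "E \<subseteq> F" "\<And>y. y \<in> F \<Longrightarrow> t \<le> sum c {x \<in> F. D x y < \<epsilon>} \<Longrightarrow> \<exists>z\<in>E. D z y < 2 * \<epsilon>"
    "real (card E) * t \<le> sum c F"
proof -
  define G where "G = {y \<in> F. t \<le> sum c {x \<in> F. D x y < \<epsilon>}}"
  define \<S> where "\<S> = {E. E \<subseteq> G \<and> (\<forall>x\<in>E. \<forall>y\<in>E. x \<noteq> y \<longrightarrow> 2 * \<epsilon> \<le> D x y)}"
  have finG: "finite G" using F by (simp add: G_def)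
  have "finite \<S>" unfolding \<S>_def using finG by simp
  moreover have "{} \<in> \<S>" by (simp add: \<S>_def)
  ultimately obtain E where E: "E \<in> \<S>" "\<And>E'. E' \<in> \<S> \<Longrightarrow> E \<subseteq> E' \<Longrightarrow> E = E'"
    using finite_has_maximal[of \<S>] by blast
  have EG: "E \<subseteq> G" and sep: "\<And>x y. x \<in> E \<Longrightarrow> y \<in> E \<Longrightarrow> x \<noteq> y \<Longrightarrow> 2 * \<epsilon> \<le> D x y"
    using E(1) by (auto simp: \<S>_def)
  show ?thesis
  proof (rule that)
    show "E \<subseteq> F" using EG by (auto simp: G_def)
    show "\<exists>z\<in>E. D z y < 2 * \<epsilon>" if "y \<in> F" "t \<le> sum c {x \<in> F. D x y < \<epsilon>}" for y
    proof (rule ccontr)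
      assume far: "\<not> ?thesis"
      have "y \<in> G" using that by (simp add: G_def)
      then have "insert y E \<in> \<S>" using EG sep far D(1) by (force simp: \<S>_def)
      then have "y \<in> E" using E(2) by blast
      then show False using far D(3) \<open>0 < \<epsilon>\<close> by force
    qed
    have "real (card E) * t = (\<Sum>y\<in>E. t)" by simp
    also have "\<dots> \<le> (\<Sum>y\<in>E. sum c {x \<in> F. D x y < \<epsilon>})"
      using EG by (intro sum_mono) (auto simp: G_def)
    also have "\<dots> = sum c (\<Union>y\<in>E. {x \<in> F. D x y < \<epsilon>})"
    proof (rule sum.UNION_disjoint[symmetric])
      show "finite E" using EG finG finite_subset by blast
      show "\<forall>y\<in>E. finite {x \<in> F. D x y < \<epsilon>}" using F by simp
      have "False" if "y \<in> E" "y' \<in> E" "y \<noteq> y'" "D x y < \<epsilon>" "D x y' < \<epsilon>" for x y y'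
        using sep[OF that(1-3)] D(2)[of y y' x] D(1)[of x y] that by linarith
      then show "\<forall>y\<in>E. \<forall>y'\<in>E. y \<noteq> y' \<longrightarrow> {x \<in> F. D x y < \<epsilon>} \<inter> {x \<in> F. D x y' < \<epsilon>} = {}" by blast
    qed
    also have "\<dots> \<le> sum c F" using F c by (intro sum_mono2) auto
    finally show "real (card E) * t \<le> sum c F" .
  qed
qed

lemma pmf_of_weights:
  fixes w :: "'a \<Rightarrow> real"
  assumes F: "finite F" and w: "\<And>x. 0 \<le> w x" "\<And>x. x \<notin> F \<Longrightarrow> w x = 0" "sum w F = 1"
  obtains p where "set_pmf p \<subseteq> F" "\<And>A. measure (measure_pmf p) A = sum w (F \<inter> A)"
proof -
  have "(\<integral>\<^sup>+x. ennreal (w x) \<partial>count_space UNIV) = (\<Sum>x\<in>F. ennreal (w x))"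
    using F w(2) by (intro nn_integral_count_space') auto
  also have "\<dots> = 1" using w by (simp add: sum_ennreal)
  finally have 1: "(\<integral>\<^sup>+x. ennreal (w x) \<partial>count_space UNIV) = 1" .
  define p where "p = embed_pmf w"
  have pmf: "pmf p x = w x" for x unfolding p_def by (rule pmf_embed_pmf[OF w(1) 1])
  have set: "set_pmf p \<subseteq> F" using w(2) by (auto simp: set_pmf_eq pmf)
  have "measure (measure_pmf p) A = sum w (F \<inter> A)" for A
  proof -
    have "measure (measure_pmf p) A = measure (measure_pmf p) (F \<inter> A)"
      by (rule measure_eq_AE) (use set in \<open>auto simp: AE_measure_pmf_iff\<close>)
    also have "\<dots> = sum w (F \<inter> A)" using F by (simp add: measure_measure_pmf_finite pmf)
    finally show ?thesis .
  qed
  with set show ?thesis by (rule that)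
qed


section \<open>Time boxes and Bowen balls\<close>

lemma finite_time_box: "finite (time_box L n :: (int ^ 'd) set)"
proof -
  have "time_box L n \<subseteq> vec_lambda ` (PiE UNIV (\<lambda>_. {- int n<..<int n}))"
  proof
    fix h :: "int ^ 'd" assume "h \<in> time_box L n"
    then have "vec_nth h \<in> PiE UNIV (\<lambda>_. {- int n<..<int n})"
      by (auto simp: time_box_def PiE_iff abs_less_iff) (metis minus_less_iff)
    then show "h \<in> vec_lambda ` (PiE UNIV (\<lambda>_. {- int n<..<int n}))"
      by (metis image_eqI vec_nth_inverse)
  qed
  then show ?thesis by (rule finite_subset) (auto intro!: finite_imageI finite_PiE)
qed

lemma time_box_size_eq:
  "time_box_size (UNIV :: (int ^ 'd) set) n = (2 * n - 1) ^ CARD('d)"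
  "time_box_size (nonneg_lattice :: (int ^ 'd) set) n = n ^ CARD('d)"
proof -
  have inj: "inj_on (vec_lambda :: ('d \<Rightarrow> int) \<Rightarrow> int ^ 'd) A" for A
    by (metis inj_on_inverseI vec_lambda_inverse UNIV_I)
  have card: "card (vec_lambda ` (PiE UNIV (\<lambda>_. A)) :: (int ^ 'd) set) = card A ^ CARD('d)" for A :: "int set"
    by (subst card_image[OF inj]) (simp add: card_PiE)
  have "time_box (UNIV :: (int ^ 'd) set) n = vec_lambda ` (PiE UNIV (\<lambda>_. {- int n<..<int n}))"
  proof safe
    fix h :: "int ^ 'd" assume "h \<in> time_box UNIV n"
    then have "vec_nth h \<in> PiE UNIV (\<lambda>_. {- int n<..<int n})"
      by (auto simp: time_box_def PiE_iff abs_less_iff) (metis minus_less_iff)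
    then show "h \<in> vec_lambda ` (PiE UNIV (\<lambda>_. {- int n<..<int n}))"
      by (metis image_eqI vec_nth_inverse)
  qed (auto simp: time_box_def PiE_iff abs_less_iff minus_less_iff)
  then have "time_box_size (UNIV :: (int ^ 'd) set) n = card {- int n<..<int n} ^ CARD('d)"
    by (simp only: time_box_size_def card)
  moreover have "card {- int n<..<int n} = 2 * n - 1" by auto
  ultimately show "time_box_size (UNIV :: (int ^ 'd) set) n = (2 * n - 1) ^ CARD('d)" by simp
  have "time_box (nonneg_lattice :: (int ^ 'd) set) n = vec_lambda ` (PiE UNIV (\<lambda>_. {0..<int n}))"
  proof safe
    fix h :: "int ^ 'd" assume "h \<in> time_box nonneg_lattice n"
    then have "vec_nth h \<in> PiE UNIV (\<lambda>_. {0..<int n})"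
      by (auto simp: time_box_def PiE_iff abs_less_iff nonneg_lattice_def)
    then show "h \<in> vec_lambda ` (PiE UNIV (\<lambda>_. {0..<int n}))"
      by (metis image_eqI vec_nth_inverse)
  qed (auto simp: time_box_def PiE_iff abs_less_iff nonneg_lattice_def, smt (verit))
  then show "time_box_size (nonneg_lattice :: (int ^ 'd) set) n = n ^ CARD('d)"
    by (simp add: time_box_size_def card)
qed

lemma neg_ln_antimono: "0 \<le> p \<Longrightarrow> p \<le> q \<Longrightarrow> neg_ln q \<le> neg_ln p"
  by (auto simp: neg_ln_def intro!: ennreal_leI)

text \<open>
  Translates the local entropy condition into a bound on the measure of a ball. The bound \<open>p \<le> 1\<close>
  keeps \<open>- ln p\<close> nonnegative, so that nothing is truncated in \<open>ennreal\<close>.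
\<close>
lemma le_neg_ln_div_ln_iff:
  assumes "0 \<le> p" "p \<le> 1" "1 < l" "0 \<le> s"
  shows "ennreal s \<le> neg_ln p / ennreal (ln l) \<longleftrightarrow> p \<le> (1 / l) powr s"
proof (cases "p = 0")
  case True
  then show ?thesis using assms by (simp add: neg_ln_def ennreal_top_divide)
next
  case False
  then have p: "0 < p" using assms by simp
  have l: "0 < ln l" using assms by simp
  have n: "0 \<le> - ln p" using p assms by simp
  have "ennreal s \<le> neg_ln p / ennreal (ln l) \<longleftrightarrow> s * ln l \<le> - ln p"
  proof -
    have "neg_ln p / ennreal (ln l) = ennreal (- ln p / ln l)"
      unfolding neg_ln_def using False l n by (simp only: divide_ennreal if_False)
    moreover have "0 \<le> - ln p / ln l" using n l by (intro divide_nonneg_pos)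
    ultimately show ?thesis using l by (simp only: ennreal_le_iff pos_le_divide_eq)
  qed
  also have "\<dots> \<longleftrightarrow> ln p \<le> ln ((1 / l) powr s)"
    using assms by (simp add: ln_powr ln_div) linarith
  also have "\<dots> \<longleftrightarrow> p \<le> (1 / l) powr s"
    using p assms by (intro ln_le_cancel_iff) auto
  finally show ?thesis .
qed

lemma continuous_on_Max_image:
  fixes f :: "'i \<Rightarrow> 'a::topological_space \<Rightarrow> real"
  assumes "finite I" "I \<noteq> {}" "\<And>i. i \<in> I \<Longrightarrow> continuous_on S (f i)"
  shows "continuous_on S (\<lambda>y. Max ((\<lambda>i. f i y) ` I))"
  using assms
proof (induction I rule: finite_ne_induct)
  case (insert i I)
  then have "(\<lambda>y. Max ((\<lambda>i. f i y) ` insert i I)) = (\<lambda>y. max (f i y) (Max ((\<lambda>i. f i y) ` I)))"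
    by (intro ext) simp
  with insert show ?case by (auto intro!: continuous_on_max)
qed simp

locale compact_lattice_action =
  fixes L :: "(int ^ 'd) set" and T :: "int ^ 'd \<Rightarrow> 'a \<Rightarrow> 'a::metric_space"
  assumes compact_space: "compact (UNIV :: 'a set)"
    and lattice: "L = UNIV \<or> L = nonneg_lattice"
    and action: "continuous_action L T"
begin

abbreviation D where "D \<equiv> bowen_dist L T"
abbreviation bball where "bball \<equiv> bowen_ball L T"
abbreviation lam where "lam n \<equiv> real (time_box_size L n)"

lemma time_box_mono: "n \<le> m \<Longrightarrow> time_box L n \<subseteq> time_box L m"
  by (auto simp: time_box_def intro: less_le_trans[where y = "int n"])

lemma zero_in_time_box: "0 < n \<Longrightarrow> 0 \<in> time_box L n"
  using lattice by (auto simp: time_box_def nonneg_lattice_def)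

lemma dist_le_D: "h \<in> time_box L n \<Longrightarrow> dist (T h x) (T h y) \<le> D n x y"
  unfolding bowen_dist_def by (intro Max_ge) (auto simp: finite_time_box)

lemma D_le: "0 < n \<Longrightarrow> (\<And>h. h \<in> time_box L n \<Longrightarrow> dist (T h x) (T h y) \<le> e) \<Longrightarrow> D n x y \<le> e"
  unfolding bowen_dist_def using zero_in_time_box[of n] by (subst Max_le_iff) (auto simp: finite_time_box)

lemma D_commute: "D n x y = D n y x"
  by (simp add: bowen_dist_def dist_commute)

lemma D_self: "0 < n \<Longrightarrow> D n x x = 0"
  using D_le[of n x x 0] dist_le_D[OF zero_in_time_box, of n x x] by simp

lemma D_triangle: "0 < n \<Longrightarrow> D n x z \<le> D n x y + D n y z"
  by (rule D_le) (auto intro: order_trans[OF dist_triangle add_mono[OF dist_le_D dist_le_D]])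

lemma D_mono: "0 < n \<Longrightarrow> n \<le> m \<Longrightarrow> D n x y \<le> D m x y"
  using time_box_mono by (intro D_le dist_le_D) auto

lemma ball_mono: "0 < n \<Longrightarrow> n \<le> m \<Longrightarrow> e \<le> e' \<Longrightarrow> bball m x e \<subseteq> bball n x e'"
  unfolding bowen_ball_def by (auto intro: le_less_trans[OF D_mono] less_le_trans)

lemma ball_mono_radius: "e \<le> e' \<Longrightarrow> bball n x e \<subseteq> bball n x e'"
  by (force simp: bowen_ball_def)

lemma continuous_on_D: "0 < n \<Longrightarrow> continuous_on UNIV (D n x)"
  using zero_in_time_box[of n] action
  unfolding bowen_dist_def[abs_def]
  by (intro continuous_on_Max_image finite_time_box continuous_on_dist)
     (auto simp: continuous_action_def time_box_def)

lemma open_ball: "0 < n \<Longrightarrow> open (bball n x e)"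
  using open_Collect_less[OF continuous_on_D continuous_on_const, of n x e] by (simp add: bowen_ball_def)

lemma ball_in_borel: "0 < n \<Longrightarrow> bball n x e \<in> sets borel"
  by (intro borel_open open_ball)

lemma lam_ge: "real n \<le> lam n"
proof (cases "n = 0")
  case False
  have 1: "n \<le> n ^ CARD('d)" using False by (intro self_le_power) auto
  have 2: "n ^ CARD('d) \<le> (2 * n - 1) ^ CARD('d)" using False by (intro power_mono) auto
  have "n \<le> time_box_size L n"
    using lattice 1 order_trans[OF 1 2] by (elim disjE) (simp_all only: time_box_size_eq)
  then show ?thesis by simp
qed simp

lemma lam_doubling: "0 < n \<Longrightarrow> m \<le> 2 * n \<Longrightarrow> lam m \<le> 4 ^ CARD('d) * lam n"
proof -
  assume n: "0 < n" "m \<le> 2 * n"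
  then have "(2 * m - 1) ^ CARD('d) \<le> (4 * (2 * n - 1)) ^ CARD('d)" "m ^ CARD('d) \<le> (4 * n) ^ CARD('d)"
    by (intro power_mono; simp)+
  then have "time_box_size L m \<le> 4 ^ CARD('d) * time_box_size L n"
    using lattice by (elim disjE) (simp_all only: time_box_size_eq power_mult_distrib)
  then show ?thesis by (metis of_nat_le_iff of_nat_mult of_nat_numeral of_nat_power)
qed

lemma inverse_lam_bounds: "0 \<le> 1 / lam n" "1 / lam n \<le> 1"
  by (cases "time_box_size L n = 0"; simp add: field_simps)+

lemma weight_antimono: "s \<le> s' \<Longrightarrow> (1 / lam n) powr s' \<le> (1 / lam n) powr s"
  using inverse_lam_bounds[of n] by (cases "time_box_size L n = 0") (auto intro!: powr_mono')

section \<open>Elementary properties of the entropies\<close>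

lemma slow_cover_sum_at_le:
  fixes I :: "nat set"
  assumes "\<And>i. i \<in> I \<Longrightarrow> N \<le> m i" "Z \<subseteq> (\<Union>i\<in>I. bball (m i) (c i) e)"
  shows "slow_cover_sum_at L T Z s N e \<le> (\<Sum>\<^sub>\<infinity>i\<in>I. ennreal ((1 / lam (m i)) powr s))"
  unfolding slow_cover_sum_at_def using assms by (intro Inf_lower) blast

lemma slow_cover_sum_at_ge:
  assumes "\<And>(I :: nat set) c m. (\<And>i. i \<in> I \<Longrightarrow> N \<le> m i) \<Longrightarrow> Z \<subseteq> (\<Union>i\<in>I. bball (m i) (c i) e) \<Longrightarrow>
    b \<le> (\<Sum>\<^sub>\<infinity>i\<in>I. ennreal ((1 / lam (m i)) powr s))"
  shows "b \<le> slow_cover_sum_at L T Z s N e"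
  unfolding slow_cover_sum_at_def using assms by (intro Inf_greatest) blast

lemma slow_cover_sum_at_le_sum:
  fixes P :: "'i set"
  assumes P: "finite P" and "\<And>i. i \<in> P \<Longrightarrow> N \<le> m i" "Z \<subseteq> (\<Union>i\<in>P. bball (m i) (c i) e)"
  shows "slow_cover_sum_at L T Z s N e \<le> ennreal (\<Sum>i\<in>P. (1 / lam (m i)) powr s)"
proof -
  obtain h where h: "bij_betw h {0..<card P} P" using ex_bij_betw_nat_finite[OF P] by blast
  have hP: "h ` {0..<card P} = P" using h by (rule bij_betw_imp_surj_on)
  have "slow_cover_sum_at L T Z s N e \<le> (\<Sum>\<^sub>\<infinity>i\<in>{0..<card P}. ennreal ((1 / lam (m (h i))) powr s))"
  proof (rule slow_cover_sum_at_le)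
    show "N \<le> m (h i)" if "i \<in> {0..<card P}" for i using assms(2) hP that by blast
    show "Z \<subseteq> (\<Union>i\<in>{0..<card P}. bball (m (h i)) (c (h i)) e)"
    proof
      fix z assume "z \<in> Z"
      then obtain p where "p \<in> P" "z \<in> bball (m p) (c p) e" using assms(3) by blast
      moreover from this(1) obtain i where "i \<in> {0..<card P}" "p = h i" using hP by blast
      ultimately show "z \<in> (\<Union>i\<in>{0..<card P}. bball (m (h i)) (c (h i)) e)" by blast
    qed
  qed
  also have "\<dots> = (\<Sum>i\<in>{0..<card P}. ennreal ((1 / lam (m (h i))) powr s))" by simp
  also have "\<dots> = (\<Sum>i\<in>P. ennreal ((1 / lam (m i)) powr s))"
    by (rule sum.reindex_bij_betw[OF h, of "\<lambda>i. ennreal ((1 / lam (m i)) powr s)"])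
  also have "\<dots> = ennreal (\<Sum>i\<in>P. (1 / lam (m i)) powr s)" by (rule sum_ennreal) simp
  finally show ?thesis .
qed

lemma slow_cover_sum_at_antimono:
  assumes "N \<le> N'" "e' \<le> e" "s' \<le> s"
  shows "slow_cover_sum_at L T Z s N e \<le> slow_cover_sum_at L T Z s' N' e'"
proof (rule slow_cover_sum_at_ge)
  fix I :: "nat set" and c m
  assume I: "\<And>i. i \<in> I \<Longrightarrow> N' \<le> m i" "Z \<subseteq> (\<Union>i\<in>I. bball (m i) (c i) e')"
  have "Z \<subseteq> (\<Union>i\<in>I. bball (m i) (c i) e)" using I(2) ball_mono_radius[OF assms(2)] by blast
  then have "slow_cover_sum_at L T Z s N e \<le> (\<Sum>\<^sub>\<infinity>i\<in>I. ennreal ((1 / lam (m i)) powr s))"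
    using I(1) assms(1) by (intro slow_cover_sum_at_le) (auto intro: order_trans)
  also have "\<dots> \<le> (\<Sum>\<^sub>\<infinity>i\<in>I. ennreal ((1 / lam (m i)) powr s'))"
    by (intro infsum_mono nonneg_summable_on_complete ennreal_leI weight_antimono assms(3)) auto
  finally show "slow_cover_sum_at L T Z s N e \<le> (\<Sum>\<^sub>\<infinity>i\<in>I. ennreal ((1 / lam (m i)) powr s'))" .
qed

lemma slow_cover_sum_eq_SUP: "slow_cover_sum L T Z s e = (SUP N. slow_cover_sum_at L T Z s N e)"
  unfolding slow_cover_sum_def
  by (intro limI LIMSEQ_SUP monoI slow_cover_sum_at_antimono) auto

lemma slow_cover_sum_antimono:
  "e' \<le> e \<Longrightarrow> s' \<le> s \<Longrightarrow> slow_cover_sum L T Z s e \<le> slow_cover_sum L T Z s' e'"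
  unfolding slow_cover_sum_eq_SUP by (intro SUP_mono' slow_cover_sum_at_antimono) auto

lemma slow_entropy_top_at_ge:
  assumes "slow_cover_sum L T Z s e \<noteq> 0"
  shows "ennreal s \<le> slow_entropy_top_at L T Z e"
  unfolding slow_entropy_top_at_def
proof (rule Inf_greatest, safe)
  fix t :: real assume "0 \<le> t" "slow_cover_sum L T Z t e = 0"
  then have "\<not> t \<le> s" using assms slow_cover_sum_antimono[of e e t s Z] by auto
  then show "ennreal s \<le> ennreal t" by (intro ennreal_leI) simp
qed

lemma slow_cover_sum_nonzero:
  assumes "0 \<le> s" "ennreal s < slow_entropy_top_at L T Z e"
  shows "slow_cover_sum L T Z s e \<noteq> 0"
proof
  assume "slow_cover_sum L T Z s e = 0"
  then have "slow_entropy_top_at L T Z e \<le> ennreal s"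
    unfolding slow_entropy_top_at_def using assms(1) by (intro Inf_lower) blast
  then show False using assms(2) by simp
qed

lemma slow_entropy_top_at_antimono:
  "e' \<le> e \<Longrightarrow> slow_entropy_top_at L T Z e \<le> slow_entropy_top_at L T Z e'"
  unfolding slow_entropy_top_at_def
proof (rule Inf_superset_mono, safe)
  fix s :: real assume "e' \<le> e" "0 \<le> s" "slow_cover_sum L T Z s e' = 0"
  moreover from this have "slow_cover_sum L T Z s e = 0"
    using slow_cover_sum_antimono[of e' e s s Z] by simp
  ultimately show "\<exists>s'. ennreal s = ennreal s' \<and> 0 \<le> s' \<and> slow_cover_sum L T Z s' e = 0" by blast
qed

lemma slow_entropy_top_eq_SUP:
  "slow_entropy_top L T Z = (SUP e\<in>{0<..}. slow_entropy_top_at L T Z e)"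
  unfolding slow_entropy_top_def
  by (intro Lim_at_right_antimono_eq_SUP slow_entropy_top_at_antimono)

lemma lower_slow_entropy_at_eq_SUP:
  assumes "\<mu> \<in> borel_prob_measures"
  shows "lower_slow_entropy_at L T \<mu> x =
    (SUP e\<in>{0<..}. liminf (\<lambda>n. neg_ln (measure \<mu> (bball n x e)) / ennreal (ln (lam n))))"
  unfolding lower_slow_entropy_at_def
proof (rule Lim_at_right_antimono_eq_SUP)
  fix e e' :: real assume e: "e \<le> e'"
  interpret prob_space \<mu> using assms by (simp add: borel_prob_measures_def)
  have sets: "sets \<mu> = sets borel" using assms by (simp add: borel_prob_measures_def)
  show "liminf (\<lambda>n. neg_ln (measure \<mu> (bball n x e')) / ennreal (ln (lam n)))
    \<le> liminf (\<lambda>n. neg_ln (measure \<mu> (bball n x e)) / ennreal (ln (lam n)))"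
  proof (rule Liminf_mono, rule eventually_sequentiallyI[of 1])
    fix n :: nat assume "1 \<le> n"
    then show "neg_ln (measure \<mu> (bball n x e')) / ennreal (ln (lam n))
      \<le> neg_ln (measure \<mu> (bball n x e)) / ennreal (ln (lam n))"
      using e ball_in_borel[of n] sets
      by (intro divide_right_mono_ennreal neg_ln_antimono finite_measure_mono ball_mono_radius) auto
  qed
qed

section \<open>Measures on a set are dominated by its covers\<close>

text \<open>
  The balls are open, so their measure is lower semicontinuous in the centre: a slightly smaller ball
  around \<open>x\<close> already has measure above \<open>c\<close>, and it is contained in the balls around all nearby
  centres.
\<close>
lemma closed_ball_measure_le:
  assumes \<mu>: "\<mu> \<in> borel_prob_measures" and n: "0 < n"
  shows "closed {x. measure \<mu> (bball n x e) \<le> c}"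
proof -
  interpret prob_space \<mu> using \<mu> by (simp add: borel_prob_measures_def)
  have sets: "sets \<mu> = sets borel" using \<mu> by (simp add: borel_prob_measures_def)
  note ball_sets = ball_in_borel[OF n, folded sets]
  have "open {x. c < measure \<mu> (bball n x e)}"
  proof (subst open_subopen, safe)
    fix x assume x: "c < measure \<mu> (bball n x e)"
    have "(\<lambda>j. measure \<mu> (bball n x (e - 1 / real (Suc j)))) \<longlonglongrightarrow>
        measure \<mu> (\<Union>j. bball n x (e - 1 / real (Suc j)))"
      by (intro finite_Lim_measure_incseq monoI ball_mono_radius)
         (use ball_sets in \<open>auto simp: frac_le\<close>)
    also have "(\<Union>j. bball n x (e - 1 / real (Suc j))) = bball n x e"
    proof (intro equalityI UN_least ball_mono_radius subsetI)
      fix y assume "y \<in> bball n x e"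
      then have "0 < e - D n x y" by (simp add: bowen_ball_def)
      from reals_Archimedean[OF this] obtain j where "1 / real (Suc j) < e - D n x y"
        unfolding inverse_eq_divide by blast
      then show "y \<in> (\<Union>j. bball n x (e - 1 / real (Suc j)))" by (auto simp: bowen_ball_def intro!: exI[of _ j])
    qed simp
    finally have "eventually (\<lambda>j. c < measure \<mu> (bball n x (e - 1 / real (Suc j)))) sequentially"
      using x by (rule order_tendstoD(1))
    then obtain j where j: "c < measure \<mu> (bball n x (e - 1 / real (Suc j)))"
      by (auto simp: eventually_sequentially)
    have "c < measure \<mu> (bball n z e)" if z: "z \<in> bball n x (1 / real (Suc j))" for z
    proof -
      have "bball n x (e - 1 / real (Suc j)) \<subseteq> bball n z e"
      proof
        fix y assume "y \<in> bball n x (e - 1 / real (Suc j))"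
        then show "y \<in> bball n z e"
          using z D_triangle[OF n, of z y x] D_commute[of n z x] by (simp add: bowen_ball_def)
      qed
      then have "measure \<mu> (bball n x (e - 1 / real (Suc j))) \<le> measure \<mu> (bball n z e)"
        using ball_sets by (intro finite_measure_mono)
      then show ?thesis using j by simp
    qed
    moreover have "x \<in> bball n x (1 / real (Suc j))" by (simp add: bowen_ball_def D_self[OF n])
    ultimately show "\<exists>U. open U \<and> x \<in> U \<and> U \<subseteq> {x. c < measure \<mu> (bball n x e)}"
      using open_ball[OF n] by blast
  qed
  then show ?thesis by (simp add: closed_def Compl_eq not_le)
qed

text \<open>
  Every ball of a cover that meets \<open>A\<close> is contained in a ball of twice the radius centred in \<open>A\<close>, whose
  measure is at most the cost of the ball.
\<close>
lemma mass_distribution: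
  assumes \<mu>: "\<mu> \<in> borel_prob_measures" and A: "A \<in> sets borel" "A \<subseteq> Z"
    and N: "0 < N"
    and le: "\<And>x n. x \<in> A \<Longrightarrow> N \<le> n \<Longrightarrow> measure \<mu> (bball n x (2 * e)) \<le> (1 / lam n) powr s"
  shows "emeasure \<mu> A \<le> slow_cover_sum L T Z s e"
proof -
  interpret prob_space \<mu> using \<mu> by (simp add: borel_prob_measures_def)
  have sets: "sets \<mu> = sets borel" using \<mu> by (simp add: borel_prob_measures_def)
  have "emeasure \<mu> A \<le> slow_cover_sum_at L T Z s N e"
  proof (rule slow_cover_sum_at_ge)
    fix I :: "nat set" and c m
    assume I: "\<And>i. i \<in> I \<Longrightarrow> N \<le> m i" "Z \<subseteq> (\<Union>i\<in>I. bball (m i) (c i) e)"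
    define I' where "I' = {i \<in> I. bball (m i) (c i) e \<inter> A \<noteq> {}}"
    have I': "N \<le> m i" "0 < m i" if "i \<in> I'" for i using that I(1)[of i] N by (auto simp: I'_def)
    have "emeasure \<mu> A \<le> (\<Sum>\<^sub>\<infinity>i\<in>I'. ennreal ((1 / lam (m i)) powr s))"
    proof (rule emeasure_UN_le_infsum)
      show "A \<in> sets \<mu>" using A sets by simp
      show "bball (m i) (c i) e \<in> sets \<mu>" if "i \<in> I'" for i using I'[OF that] ball_in_borel sets by simp
      show "A \<subseteq> (\<Union>i\<in>I'. bball (m i) (c i) e)" using A(2) I(2) by (auto simp: I'_def) blast
      fix i assume i: "i \<in> I'"
      then obtain y where y: "y \<in> A" "y \<in> bball (m i) (c i) e" by (auto simp: I'_def)
      have "bball (m i) (c i) e \<subseteq> bball (m i) y (2 * e)"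
      proof
        fix z assume "z \<in> bball (m i) (c i) e"
        then show "z \<in> bball (m i) y (2 * e)"
          using y(2) D_triangle[OF I'(2)[OF i], of y z "c i"] D_commute[of "m i" y "c i"] by (simp add: bowen_ball_def)
      qed
      then have "measure \<mu> (bball (m i) (c i) e) \<le> measure \<mu> (bball (m i) y (2 * e))"
        using ball_in_borel[OF I'(2)[OF i]] sets by (intro finite_measure_mono) auto
      also have "\<dots> \<le> (1 / lam (m i)) powr s" using le y(1) I'(1)[OF i] by blast
      finally show "emeasure \<mu> (bball (m i) (c i) e) \<le> ennreal ((1 / lam (m i)) powr s)"
        unfolding emeasure_eq_measure by (rule ennreal_leI)
    qed
    also have "\<dots> \<le> (\<Sum>\<^sub>\<infinity>i\<in>I. ennreal ((1 / lam (m i)) powr s))"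
      by (rule infsum_mono_neutral) (auto simp: I'_def nonneg_summable_on_complete)
    finally show "emeasure \<mu> A \<le> (\<Sum>\<^sub>\<infinity>i\<in>I. ennreal ((1 / lam (m i)) powr s))" .
  qed
  also have "\<dots> \<le> slow_cover_sum L T Z s e" unfolding slow_cover_sum_eq_SUP by (rule SUP_upper) simp
  finally show ?thesis .
qed

theorem lower_slow_entropy_le_top:
  assumes \<mu>: "\<mu> \<in> borel_prob_measures" and K: "K \<in> sets borel" "measure \<mu> K = 1"
  shows "lower_slow_entropy L T \<mu> \<le> slow_entropy_top L T K"
proof (rule ccontr)
  interpret prob_space \<mu> using \<mu> by (simp add: borel_prob_measures_def)
  have sets: "sets \<mu> = sets borel" using \<mu> by (simp add: borel_prob_measures_def)
  assume "\<not> ?thesis"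
  then obtain t where t: "slow_entropy_top L T K < t" "t < lower_slow_entropy L T \<mu>"
    using dense by (metis not_le)
  then obtain s where s: "0 \<le> s" "t = ennreal s" by (cases t) auto
  obtain A where A: "A \<in> sets \<mu>" "0 < emeasure \<mu> A" "\<And>x. x \<in> A \<Longrightarrow> ennreal s < lower_slow_entropy_at L T \<mu> x"
    using nn_integral_gt_imp_pos_measure[OF prob_space_axioms] t(2) unfolding s(2) lower_slow_entropy_def by blast
  define r where "r k = 1 / real (Suc k)" for k
  \<comment> \<open>The radius and the first time at which the ball bound holds depend on the point; \<open>C k\<close> fixes both.\<close>
  define C where "C k = (\<Inter>n\<in>{Suc k..}. {x. measure \<mu> (bball n x (r k)) \<le> (1 / lam n) powr s})" for k
  have C: "C k \<in> sets borel" for k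
    unfolding C_def by (intro borel_closed closed_INT ballI closed_ball_measure_le[OF \<mu>]) auto
  have "A \<subseteq> (\<Union>k. C k)"
  proof
    fix x assume "x \<in> A"
    from A(3)[OF this] obtain e where e: "0 < e"
      "ennreal s < liminf (\<lambda>n. neg_ln (measure \<mu> (bball n x e)) / ennreal (ln (lam n)))"
      unfolding lower_slow_entropy_at_eq_SUP[OF \<mu>] by (auto simp: less_SUP_iff)
    then obtain k0 where k0: "\<And>n. k0 \<le> n \<Longrightarrow> ennreal s < neg_ln (measure \<mu> (bball n x e)) / ennreal (ln (lam n))"
      using less_LiminfD[OF e(2)] by (auto simp: eventually_sequentially)
    obtain k1 where k1: "r k1 < e" unfolding r_def using reals_Archimedean[OF e(1)] unfolding inverse_eq_divide by blast
    define k where "k = Max {k0, k1, 2}"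
    have k: "k0 \<le> k" "k1 \<le> k" "2 \<le> k" by (auto simp: k_def)
    have "r k \<le> r k1" unfolding r_def using k(2) by (intro divide_left_mono) auto
    then have rk: "r k \<le> e" using k1 by simp
    have "measure \<mu> (bball n x (r k)) \<le> (1 / lam n) powr s" if n: "Suc k \<le> n" for n
    proof -
      have "measure \<mu> (bball n x (r k)) \<le> measure \<mu> (bball n x e)"
        using n ball_in_borel[of n] sets by (intro finite_measure_mono ball_mono_radius rk) auto
      also have "\<dots> \<le> (1 / lam n) powr s"
      proof (subst le_neg_ln_div_ln_iff[symmetric])
        show "1 < lam n" using lam_ge[of n] n k(3) by linarith
        show "ennreal s \<le> neg_ln (measure \<mu> (bball n x e)) / ennreal (ln (lam n))"
          using k0[of n] n k(1) by simp
      qed (use s(1) in auto)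
      finally show ?thesis .
    qed
    then show "x \<in> (\<Union>k. C k)" by (auto simp: C_def)
  qed
  have "emeasure \<mu> (A \<inter> K) = emeasure \<mu> A"
  proof (rule emeasure_eq_AE)
    have "AE x in \<mu>. x \<in> K" using K sets by (simp add: AE_in_set_eq_1)
    then show "AE x in \<mu>. x \<in> A \<inter> K \<longleftrightarrow> x \<in> A" by eventually_elim simp
  qed (use A K sets in auto)
  then have pos: "0 < emeasure \<mu> (A \<inter> K)" using A(2) by simp
  have "\<exists>k. 0 < emeasure \<mu> (A \<inter> K \<inter> C k)"
  proof (rule ccontr)
    assume "\<not> ?thesis"
    then have "emeasure \<mu> (\<Union>k. A \<inter> K \<inter> C k) = 0"
      using A(1) K(1) C sets by (intro emeasure_UN_eq_0) (auto simp: zero_less_iff_neq_zero)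
    moreover have "(\<Union>k. A \<inter> K \<inter> C k) = A \<inter> K" using \<open>A \<subseteq> (\<Union>k. C k)\<close> by blast
    ultimately show False using pos by simp
  qed
  then obtain k where k: "0 < emeasure \<mu> (A \<inter> K \<inter> C k)" by blast
  also have "\<dots> \<le> slow_cover_sum L T K s (r k / 2)"
  proof (rule mass_distribution[OF \<mu>])
    show "A \<inter> K \<inter> C k \<in> sets borel" using A(1) K(1) C sets by auto
    show "measure \<mu> (bball n x (2 * (r k / 2))) \<le> (1 / lam n) powr s"
      if "x \<in> A \<inter> K \<inter> C k" "Suc k \<le> n" for x n using that by (auto simp: C_def)
  qed auto
  finally have "ennreal s \<le> slow_entropy_top_at L T K (r k / 2)"
    by (intro slow_entropy_top_at_ge) simp
  also have "\<dots> \<le> slow_entropy_top L T K"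
    unfolding slow_entropy_top_eq_SUP by (rule SUP_upper) (simp add: r_def)
  finally show False using t(1) s(2) by simp
qed

section \<open>From fractional covers to covers\<close>

text \<open>
  Split the unit of weight that covers a point of the net among the times: the thresholds
  \<open>t k = (1 - q) * q ^ k\<close> add up to less than 1, so every point \<open>y\<close> of \<open>F\<close> has a time \<open>2 ^ k\<close> at which
  it receives at least \<open>t k\<close>. For each \<open>k\<close> the points that are heavy in this sense lie in balls of
  radius \<open>2e\<close> around a set \<open>E k\<close> whose size is at most the total weight at time \<open>2 ^ k\<close> divided by
  \<open>t k\<close>. The loss \<open>1 / t k\<close> is compensated by the larger exponent: raising it from \<open>s\<close> to \<open>s'\<close>
  gains the factor \<open>q ^ k\<close>, because \<open>\<lambda>\<close> is at least \<open>2 ^ k\<close> at time \<open>2 ^ k\<close>. The net costs a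
  further \<open>e\<close> of radius.
\<close>
lemma slow_cover_sum_le_fractional_cover:
  fixes c :: "nat \<times> 'a \<Rightarrow> real"
  assumes F: "finite F" and net: "Z \<subseteq> (\<Union>x\<in>F. bball (2 ^ M) x e)"
    and s: "s < s'" and e: "0 < e" and q: "q = 2 powr (s - s')"
    and c: "\<And>j. j \<in> {N..M} \<times> F \<Longrightarrow> 0 \<le> c j"
    and cover: "\<And>y. y \<in> F \<Longrightarrow> 1 \<le> sum c {j \<in> {N..M} \<times> F. y \<in> bball (2 ^ fst j) (snd j) e}"
  shows "slow_cover_sum_at L T Z s' N (3 * e)
    \<le> ennreal ((\<Sum>j\<in>{N..M} \<times> F. c j * (1 / lam (2 ^ fst j)) powr s) / (1 - q))"
proof -
  have q01: "0 < q" "q < 1" using s by (simp_all add: q powr_less_one)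
  define t where "t k = (1 - q) * q ^ k" for k :: nat
  have t0: "0 < t k" for k using q01 by (simp add: t_def)
  define E where "E k = (SOME E. E \<subseteq> F \<and>
      (\<forall>y\<in>F. t k \<le> (\<Sum>x | x \<in> F \<and> D (2 ^ k) x y < e. c (k, x)) \<longrightarrow> (\<exists>z\<in>E. D (2 ^ k) z y < 2 * e)) \<and>
      real (card E) * t k \<le> (\<Sum>x\<in>F. c (k, x)))" for k
  have E: "E k \<subseteq> F \<and>
      (\<forall>y\<in>F. t k \<le> (\<Sum>x | x \<in> F \<and> D (2 ^ k) x y < e. c (k, x)) \<longrightarrow> (\<exists>z\<in>E k. D (2 ^ k) z y < 2 * e)) \<and>
      real (card (E k)) * t k \<le> (\<Sum>x\<in>F. c (k, x))" if k: "k \<in> {N..M}" for k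
    unfolding E_def
  proof (rule someI_ex)
    obtain E' where "E' \<subseteq> F"
      "\<And>y. y \<in> F \<Longrightarrow> t k \<le> (\<Sum>x | x \<in> F \<and> D (2 ^ k) x y < e. c (k, x)) \<Longrightarrow> \<exists>z\<in>E'. D (2 ^ k) z y < 2 * e"
      "real (card E') * t k \<le> (\<Sum>x\<in>F. c (k, x))"
      by (rule separated_net_of_heavy_points[of F "D (2 ^ k)" "\<lambda>x. c (k, x)" e "t k"])
         (use F e k c in \<open>auto intro: D_commute D_triangle D_self\<close>)
    then show "\<exists>E. E \<subseteq> F \<and>
      (\<forall>y\<in>F. t k \<le> (\<Sum>x | x \<in> F \<and> D (2 ^ k) x y < e. c (k, x)) \<longrightarrow> (\<exists>z\<in>E. D (2 ^ k) z y < 2 * e)) \<and>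
      real (card E) * t k \<le> (\<Sum>x\<in>F. c (k, x))" by blast
  qed
  have heavy: "\<exists>k\<in>{N..M}. t k \<le> (\<Sum>x | x \<in> F \<and> D (2 ^ k) x y < e. c (k, x))" if y: "y \<in> F" for y
  proof (rule ccontr)
    assume light: "\<not> ?thesis"
    have "sum c {j \<in> {N..M} \<times> F. y \<in> bball (2 ^ fst j) (snd j) e}
        = sum c (Sigma {N..M} (\<lambda>k. {x. x \<in> F \<and> D (2 ^ k) x y < e}))"
      by (rule sum.cong) (auto simp: bowen_ball_def)
    also have "\<dots> = (\<Sum>k\<in>{N..M}. \<Sum>x | x \<in> F \<and> D (2 ^ k) x y < e. c (k, x))"
      using F by (subst sum.Sigma) auto
    also have "\<dots> \<le> (\<Sum>k\<in>{N..M}. t k)" using light by (intro sum_mono) (auto simp: not_le intro: less_imp_le)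
    also have "\<dots> \<le> (\<Sum>k\<in>{..M}. t k)" using t0 by (intro sum_mono2) (auto intro: less_imp_le)
    also have "\<dots> = 1 - q ^ Suc M"
      unfolding t_def sum_distrib_left[symmetric] lessThan_Suc_atMost[symmetric]
      using q01 by (simp only: one_diff_power_eq)
    also have "\<dots> < 1" using q01 by simp
    finally show False using cover[OF y] by simp
  qed
  define P where "P = Sigma {N..M} E"
  have finE: "finite (E k)" if "k \<in> {N..M}" for k using E[OF that] F finite_subset by blast
  have "slow_cover_sum_at L T Z s' N (3 * e) \<le> ennreal (\<Sum>i\<in>P. (1 / lam (2 ^ fst i)) powr s')"
  proof (rule slow_cover_sum_at_le_sum)
    show "finite P" unfolding P_def using finE by auto
    have "k \<le> 2 ^ k" for k :: nat by (simp add: less_imp_le)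
    then show "N \<le> 2 ^ fst i" if "i \<in> P" for i using that by (auto simp: P_def intro: order_trans)
    show "Z \<subseteq> (\<Union>i\<in>P. bball (2 ^ fst i) (snd i) (3 * e))"
    proof
      fix z assume "z \<in> Z"
      then obtain y where y: "y \<in> F" "D (2 ^ M) y z < e" using net by (auto simp: bowen_ball_def)
      obtain k where k: "k \<in> {N..M}" "t k \<le> (\<Sum>x | x \<in> F \<and> D (2 ^ k) x y < e. c (k, x))"
        using heavy[OF y(1)] by blast
      then obtain x where x: "x \<in> E k" "D (2 ^ k) x y < 2 * e" using E y(1) by blast
      have "D (2 ^ k) y z \<le> D (2 ^ M) y z" using k(1) by (intro D_mono) auto
      then have "D (2 ^ k) x z < 3 * e" using D_triangle[of "2 ^ k" x z y] x(2) y(2) by simp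
      then show "z \<in> (\<Union>i\<in>P. bball (2 ^ fst i) (snd i) (3 * e))"
        using k(1) x(1) by (force simp: P_def bowen_ball_def)
    qed
  qed
  also have "(\<Sum>i\<in>P. (1 / lam (2 ^ fst i)) powr s') = (\<Sum>k\<in>{N..M}. \<Sum>x\<in>E k. (1 / lam (2 ^ k)) powr s')"
    unfolding P_def using finE by (subst sum.Sigma) (auto simp: case_prod_beta)
  also have "\<dots> \<le> (\<Sum>k\<in>{N..M}. (\<Sum>x\<in>F. c (k, x) * (1 / lam (2 ^ k)) powr s) / (1 - q))"
  proof (rule sum_mono)
    fix k assume k: "k \<in> {N..M}"
    have l: "2 ^ k \<le> lam (2 ^ k)" using lam_ge[of "2 ^ k"] by simp
    have lp: "0 < lam (2 ^ k)" using l by (smt (verit) zero_less_power)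
    have "(1 / lam (2 ^ k)) powr s' = (1 / lam (2 ^ k)) powr s * (1 / lam (2 ^ k)) powr (s' - s)"
      by (simp add: powr_add[symmetric])
    also have "(1 / lam (2 ^ k)) powr (s' - s) \<le> (1 / 2 ^ k) powr (s' - s)"
      using s l lp by (intro powr_mono2 divide_left_mono) auto
    also have "\<dots> = q ^ k"
      unfolding q by (simp add: powr_divide powr_realpow[symmetric] powr_powr powr_minus_divide[symmetric] algebra_simps)
    finally have "(1 / lam (2 ^ k)) powr s' \<le> (1 / lam (2 ^ k)) powr s * q ^ k"
      by (simp add: mult_left_mono)
    then have "(\<Sum>x\<in>E k. (1 / lam (2 ^ k)) powr s') \<le> real (card (E k)) * ((1 / lam (2 ^ k)) powr s * q ^ k)"
      by (simp add: mult_left_mono)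
    also have "\<dots> = (real (card (E k)) * t k) * ((1 / lam (2 ^ k)) powr s / (1 - q))"
      using q01 by (simp add: t_def)
    also have "\<dots> \<le> (\<Sum>x\<in>F. c (k, x)) * ((1 / lam (2 ^ k)) powr s / (1 - q))"
      using E[OF k] q01 by (intro mult_right_mono) auto
    finally show "(\<Sum>x\<in>E k. (1 / lam (2 ^ k)) powr s') \<le> (\<Sum>x\<in>F. c (k, x) * (1 / lam (2 ^ k)) powr s) / (1 - q)"
      by (simp add: sum_distrib_right)
  qed
  also have "\<dots> = (\<Sum>j\<in>{N..M} \<times> F. c j * (1 / lam (2 ^ fst j)) powr s) / (1 - q)"
    using F by (simp add: sum.cartesian_product sum_divide_distrib case_prod_beta)
  finally show ?thesis by (simp add: ennreal_leI)
qed

section \<open>Frostman measures\<close>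

text \<open>
  Duality on a finite net, fine for the largest time \<open>2 ^ M\<close>. The constant does not depend on \<open>M\<close>.
  The dual weights control balls centred in the net; a ball of radius \<open>e / 2\<close> with any other
  centre either misses the net or is contained in one of those.
\<close>
lemma finite_frostman:
  assumes K: "compact K" "K \<noteq> {}" and s: "s < s'" and e: "0 < e"
    and \<beta>: "0 < \<beta>" "ennreal \<beta> \<le> slow_cover_sum_at L T K s' N (3 * e)"
  obtains p where "set_pmf p \<subseteq> K"
    "\<And>k x. N \<le> k \<Longrightarrow> k \<le> M \<Longrightarrow> measure (measure_pmf p) (bball (2 ^ k) x (e / 2))
        \<le> 3 / (\<beta> * (1 - 2 powr (s - s'))) * (1 / lam (2 ^ k)) powr s"
proof -
  define q where "q = 2 powr (s - s')"
  have q01: "0 < q" "q < 1" using s by (simp_all add: q_def powr_less_one)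
  obtain F where F: "F \<subseteq> K" "finite F" "K \<subseteq> (\<Union>x\<in>F. bball (2 ^ M) x e)"
  proof (rule compactE_image[OF K(1), of K "\<lambda>x. bball (2 ^ M) x e"])
    show "open (bball (2 ^ M) x e)" for x by (rule open_ball) simp
    show "K \<subseteq> (\<Union>x\<in>K. bball (2 ^ M) x e)" using e by (auto simp: bowen_ball_def D_self)
  qed blast
  have "F \<noteq> {}" using F(3) K(2) by auto
  define b where "b j = (1 / lam (2 ^ fst j)) powr s" for j :: "nat \<times> 'a"
  have lp: "0 < lam (2 ^ k)" for k using lam_ge[of "2 ^ k"] by (smt (verit) of_nat_0_less_iff zero_less_numeral zero_less_power)
  obtain w where w: "\<And>x. 0 \<le> w x" "\<And>x. x \<notin> F \<Longrightarrow> w x = 0" "sum w F = 1"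
    and wb: "\<And>j. j \<in> {N..M} \<times> F \<Longrightarrow> sum w (F \<inter> bball (2 ^ fst j) (snd j) e) \<le> 3 / (\<beta> * (1 - q)) * b j"
  proof (rule fractional_cover_dual_weights[OF F(2) \<open>F \<noteq> {}\<close>, of "{N..M} \<times> F" b "\<beta> * (1 - q)" "\<lambda>j. bball (2 ^ fst j) (snd j) e"])
    show "finite ({N..M} \<times> F)" using F(2) by simp
    show "0 < b j" for j using lp by (simp add: b_def less_imp_neq[THEN not_sym])
    show "0 < \<beta> * (1 - q)" using \<beta>(1) q01 by simp
    fix c :: "nat \<times> 'a \<Rightarrow> real"
    assume c: "\<And>j. j \<in> {N..M} \<times> F \<Longrightarrow> 0 \<le> c j"
      "\<And>y. y \<in> F \<Longrightarrow> 1 \<le> sum c {j \<in> {N..M} \<times> F. y \<in> bball (2 ^ fst j) (snd j) e}"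
    have "ennreal \<beta> \<le> ennreal ((\<Sum>j\<in>{N..M} \<times> F. c j * b j) / (1 - q))"
      unfolding b_def
      by (rule order_trans[OF \<beta>(2) slow_cover_sum_le_fractional_cover[OF F(2,3) s e q_def c]])
    moreover have "0 \<le> (\<Sum>j\<in>{N..M} \<times> F. c j * b j) / (1 - q)"
      using c(1) q01 by (intro divide_nonneg_pos sum_nonneg mult_nonneg_nonneg) (auto simp: b_def)
    ultimately have "\<beta> \<le> (\<Sum>j\<in>{N..M} \<times> F. c j * b j) / (1 - q)"
      by (simp add: ennreal_le_iff)
    then show "\<beta> * (1 - q) \<le> (\<Sum>j\<in>{N..M} \<times> F. c j * b j)" using q01 by (simp add: pos_le_divide_eq)
  qed blast
  obtain p where p: "set_pmf p \<subseteq> F" "\<And>A. measure (measure_pmf p) A = sum w (F \<inter> A)"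
    using pmf_of_weights[OF F(2) w] by blast
  show ?thesis
  proof (rule that)
    show "set_pmf p \<subseteq> K" using p(1) F(1) by blast
    fix k x assume k: "N \<le> k" "k \<le> M"
    have C0: "0 \<le> 3 / (\<beta> * (1 - q)) * (1 / lam (2 ^ k)) powr s" using \<beta>(1) q01 by simp
    show "measure (measure_pmf p) (bball (2 ^ k) x (e / 2))
        \<le> 3 / (\<beta> * (1 - 2 powr (s - s'))) * (1 / lam (2 ^ k)) powr s"
    proof (cases "F \<inter> bball (2 ^ k) x (e / 2) = {}")
      case True
      then show ?thesis using C0 p(2) by (simp add: q_def)
    next
      case False
      then obtain y where y: "y \<in> F" "D (2 ^ k) x y < e / 2" by (auto simp: bowen_ball_def)
      have "bball (2 ^ k) x (e / 2) \<subseteq> bball (2 ^ k) y e"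
      proof
        fix z assume "z \<in> bball (2 ^ k) x (e / 2)"
        then show "z \<in> bball (2 ^ k) y e"
          using y(2) D_triangle[of "2 ^ k" y z x] D_commute[of "2 ^ k" x y] by (simp add: bowen_ball_def)
      qed
      then have "sum w (F \<inter> bball (2 ^ k) x (e / 2)) \<le> sum w (F \<inter> bball (2 ^ k) y e)"
        using F(2) w(1) by (intro sum_mono2) auto
      also have "\<dots> \<le> 3 / (\<beta> * (1 - q)) * (1 / lam (2 ^ k)) powr s"
        using wb[of "(k, y)"] k y(1) by (simp add: b_def)
      finally show ?thesis by (simp add: p(2) q_def)
    qed
  qed
qed

text \<open>
  The limit of the measures for times up to \<open>2 ^ M\<close>. The ball bounds pass to the weak limit
  by testing with a continuous function between the indicators of the balls of radius \<open>e / 4\<close> and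
  \<open>e / 2\<close>.
\<close>
lemma frostman_measure:
  assumes K: "compact K" "K \<noteq> {}" and s: "s < s'" and e: "0 < e"
    and M: "slow_cover_sum L T K s' (3 * e) \<noteq> 0"
  obtains \<mu> C N where "\<mu> \<in> borel_prob_measures" "measure \<mu> K = 1"
    "\<And>k x. N \<le> k \<Longrightarrow> measure \<mu> (bball (2 ^ k) x (e / 4)) \<le> C * (1 / lam (2 ^ k)) powr s"
proof -
  have Kb: "K \<in> sets borel" using K(1) by (simp add: compact_imp_closed)
  from M obtain N where "slow_cover_sum_at L T K s' N (3 * e) \<noteq> 0"
    unfolding slow_cover_sum_eq_SUP by (metis (no_types, lifting) SUP_eqI le_zero_eq order_refl zero_le)
  then have "0 < slow_cover_sum_at L T K s' N (3 * e)" by (simp add: zero_less_iff_neq_zero)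
  then obtain b where b: "0 < b" "b < slow_cover_sum_at L T K s' N (3 * e)" using dense by blast
  then obtain \<beta> where \<beta>: "b = ennreal \<beta>" "0 < \<beta>" by (cases b) auto
  define C where "C = 3 / (\<beta> * (1 - 2 powr (s - s')))"
  have "\<exists>p. set_pmf p \<subseteq> K \<and> (\<forall>k x. N \<le> k \<longrightarrow> k \<le> M \<longrightarrow>
      measure (measure_pmf p) (bball (2 ^ k) x (e / 2)) \<le> C * (1 / lam (2 ^ k)) powr s)" for M
    using finite_frostman[OF K s e \<beta>(2), of N M] b(2) \<beta>(1) unfolding C_def by (metis less_imp_le)
  then have "\<forall>M. \<exists>p. set_pmf p \<subseteq> K \<and> (\<forall>k x. N \<le> k \<longrightarrow> k \<le> M \<longrightarrow>
      measure (measure_pmf p) (bball (2 ^ k) x (e / 2)) \<le> C * (1 / lam (2 ^ k)) powr s)" by (rule allI)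
  from choice[OF this] obtain p where p: "\<And>M. set_pmf (p M) \<subseteq> K"
    "\<And>M k x. N \<le> k \<Longrightarrow> k \<le> M \<Longrightarrow>
      measure (measure_pmf (p M)) (bball (2 ^ k) x (e / 2)) \<le> C * (1 / lam (2 ^ k)) powr s" by blast
  define P where "P M = distr (measure_pmf (p M)) borel (\<lambda>x. x)" for M
  have P_measure: "emeasure (P M) A = emeasure (measure_pmf (p M)) A" if "A \<in> sets borel" for M A
    unfolding P_def using that by (subst emeasure_distr) auto
  have prob: "prob_space (P M)" for M
    unfolding P_def by (rule measure_pmf.prob_space_distr) simp
  have PK: "emeasure (P M) K = 1" for M
    using P_measure[OF Kb] p(1)[of M] measure_pmf.emeasure_eq_1_AE[of K "p M"]
    by (auto simp: AE_measure_pmf_iff)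
  obtain r \<mu> where r: "strict_mono (r :: nat \<Rightarrow> nat)" and \<mu>: "prob_space \<mu>" "sets \<mu> = sets borel" "measure \<mu> K = 1"
    and lim: "\<And>f :: 'a \<Rightarrow> real. continuous_on UNIV f \<Longrightarrow> (\<lambda>n. \<integral>x. f x \<partial>P (r n)) \<longlonglongrightarrow> (\<integral>x. f x \<partial>\<mu>)"
    by (rule compact_prob_measures_weak_limit[OF K(1), of P]) (use prob PK in \<open>auto simp: P_def\<close>)
  interpret prob_space \<mu> by fact
  have "measure \<mu> (bball (2 ^ k) x (e / 4)) \<le> C * (1 / lam (2 ^ k)) powr s" if k: "N \<le> k" for k x
  proof -
    define f where "f y = min 1 (max 0 (2 - 4 * D (2 ^ k) x y / e))" for y
    have f: "continuous_on UNIV f" unfolding f_def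
      using continuous_on_D[of "2 ^ k" x] e
      by (intro continuous_on_min continuous_on_max continuous_on_diff continuous_on_divide
          continuous_on_mult continuous_on_const) auto
    have fm: "f \<in> borel_measurable borel" using f by (rule borel_measurable_continuous_onI)
    have f01: "0 \<le> f y" "f y \<le> 1" for y by (auto simp: f_def)
    have lower: "indicat_real (bball (2 ^ k) x (e / 4)) y \<le> f y" for y
      using e by (auto simp: f_def bowen_ball_def indicator_def field_simps)
    have upper: "f y \<le> indicat_real (bball (2 ^ k) x (e / 2)) y" for y
      using e by (auto simp: f_def bowen_ball_def indicator_def field_simps)
    have sets_ball: "bball (2 ^ k) x d \<in> sets borel" for d by (rule ball_in_borel) simp
    have "measure \<mu> (bball (2 ^ k) x (e / 4)) = (\<integral>y. indicat_real (bball (2 ^ k) x (e / 4)) y \<partial>\<mu>)"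
      using sets_ball \<mu>(2) by simp
    also have "\<dots> \<le> (\<integral>y. f y \<partial>\<mu>)"
    proof (rule integral_mono)
      show "integrable \<mu> (indicat_real (bball (2 ^ k) x (e / 4)))"
        using sets_ball \<mu>(2) by (simp add: emeasure_eq_measure)
      show "integrable \<mu> f"
        using f01 fm measurable_cong_sets[OF \<mu>(2) refl] by (intro integrable_const_bound[of _ 1]) auto
    qed (rule lower)
    also have "(\<integral>y. f y \<partial>\<mu>) \<le> C * (1 / lam (2 ^ k)) powr s"
    proof (rule LIMSEQ_le_const2[OF lim[OF f]], intro exI allI impI)
      fix n assume n: "k \<le> n"
      then have kn: "k \<le> r n" using seq_suble[OF r, of n] by simp
      interpret Pn: prob_space "P (r n)" by (rule prob)
      have sP: "sets (P (r n)) = sets borel" by (simp add: P_def)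
      have "(\<integral>y. f y \<partial>P (r n)) \<le> (\<integral>y. indicat_real (bball (2 ^ k) x (e / 2)) y \<partial>P (r n))"
      proof (rule integral_mono)
        show "integrable (P (r n)) (indicat_real (bball (2 ^ k) x (e / 2)))"
          using sets_ball sP by (simp add: Pn.emeasure_eq_measure)
        show "integrable (P (r n)) f"
          using f01 fm measurable_cong_sets[OF sP refl] by (intro Pn.integrable_const_bound[of _ 1]) auto
      qed (rule upper)
      also have "\<dots> = measure (P (r n)) (bball (2 ^ k) x (e / 2))" using sets_ball sP by simp
      also have "\<dots> = measure (measure_pmf (p (r n))) (bball (2 ^ k) x (e / 2))"
        using P_measure[OF sets_ball] by (simp add: measure_def)
      also have "\<dots> \<le> C * (1 / lam (2 ^ k)) powr s" by (rule p(2)[OF k kn])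
      finally show "(\<integral>y. f y \<partial>P (r n)) \<le> C * (1 / lam (2 ^ k)) powr s" .
    qed
    finally show ?thesis .
  qed
  then show ?thesis using that[of \<mu> N C] \<mu> by (simp add: borel_prob_measures_def)
qed

text \<open>
  Between \<open>2 ^ k\<close> and \<open>2 ^ (k + 1)\<close> the balls shrink, while \<open>\<lambda>\<close> grows by a bounded factor only. The
  strict inequality \<open>a < s\<close> absorbs the constants, since \<open>\<lambda>\<close> tends to infinity.
\<close>
lemma lower_slow_entropy_ge:
  assumes \<mu>: "\<mu> \<in> borel_prob_measures" and e: "0 < e" and a: "0 \<le> a" "a < s"
    and bound: "\<And>k x. N \<le> k \<Longrightarrow> measure \<mu> (bball (2 ^ k) x e) \<le> C * (1 / lam (2 ^ k)) powr s"
  shows "ennreal a \<le> lower_slow_entropy L T \<mu>"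
proof -
  interpret prob_space \<mu> using \<mu> by (simp add: borel_prob_measures_def)
  have sets: "sets \<mu> = sets borel" using \<mu> by (simp add: borel_prob_measures_def)
  have lam_top: "filterlim lam at_top sequentially"
    by (rule filterlim_at_top_mono[OF filterlim_real_sequentially]) (intro always_eventually allI lam_ge)
  define C' where "C' = \<bar>C\<bar> * (4 ^ CARD('d)) powr s"
  have "((\<lambda>n. C' * (lam n) powr (a - s)) \<longlongrightarrow> C' * 0) sequentially"
    using a(2) by (intro tendsto_mult tendsto_const tendsto_neg_powr[OF _ lam_top]) simp
  then have "eventually (\<lambda>n. C' * (lam n) powr (a - s) < 1) sequentially"
    by (rule order_tendstoD) simp
  then have ev: "eventually (\<lambda>n. C' * (lam n) powr (a - s) < 1 \<and> 2 \<le> n \<and> 2 ^ N \<le> n) sequentially"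
    by (intro eventually_conj eventually_ge_at_top)
  have "ennreal a \<le> lower_slow_entropy_at L T \<mu> x" for x
  proof -
    have "ennreal a \<le> liminf (\<lambda>n. neg_ln (measure \<mu> (bball n x e)) / ennreal (ln (lam n)))"
    proof (rule Liminf_bounded, rule eventually_mono[OF ev], elim conjE)
      fix n :: nat assume n: "C' * (lam n) powr (a - s) < 1" "2 \<le> n" "2 ^ N \<le> n"
      obtain k where k: "2 ^ k \<le> n" "n < 2 ^ Suc k"
        using ex_power_ivl1[of 2 n] n(2) by auto
      have "(2 :: nat) ^ N < 2 ^ Suc k" using n(3) k(2) by simp
      then have "N < Suc k" by (rule power_less_imp_less_exp[rotated]) simp
      then have "N \<le> k" by simp
      have l: "1 < lam n" using lam_ge[of n] n(2) by linarith
      have lk: "0 < lam (2 ^ k)" using lam_ge[of "2 ^ k"] by (smt (verit) of_nat_0_less_iff zero_less_numeral zero_less_power)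
      have "lam n \<le> 4 ^ CARD('d) * lam (2 ^ k)" using k by (intro lam_doubling) auto
      then have "1 / lam (2 ^ k) \<le> 4 ^ CARD('d) * (1 / lam n)" using l lk by (simp add: field_simps)
      then have "(1 / lam (2 ^ k)) powr s \<le> (4 ^ CARD('d) * (1 / lam n)) powr s"
        using a by (intro powr_mono2) auto
      also have "\<dots> = (4 ^ CARD('d)) powr s * (1 / lam n) powr s" by (rule powr_mult)
      finally have p: "(1 / lam (2 ^ k)) powr s \<le> (4 ^ CARD('d)) powr s * (1 / lam n) powr s" .
      have "measure \<mu> (bball n x e) \<le> measure \<mu> (bball (2 ^ k) x e)"
        using k(1) ball_in_borel[of "2 ^ k"] sets by (intro finite_measure_mono ball_mono) auto
      also have "\<dots> \<le> C * (1 / lam (2 ^ k)) powr s" by (rule bound[OF \<open>N \<le> k\<close>])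
      also have "\<dots> \<le> \<bar>C\<bar> * (1 / lam (2 ^ k)) powr s" by (intro mult_right_mono) auto
      also have "\<dots> \<le> \<bar>C\<bar> * ((4 ^ CARD('d)) powr s * (1 / lam n) powr s)" by (intro mult_left_mono p) auto
      also have "\<dots> = C' * (lam n) powr (a - s) * (1 / lam n) powr a"
        using l by (simp add: C'_def powr_divide powr_diff)
      also have "\<dots> \<le> 1 * (1 / lam n) powr a" using n(1) by (intro mult_right_mono) auto
      finally have "measure \<mu> (bball n x e) \<le> (1 / lam n) powr a" by simp
      then show "ennreal a \<le> neg_ln (measure \<mu> (bball n x e)) / ennreal (ln (lam n))"
        using l a by (subst le_neg_ln_div_ln_iff) auto
    qed
    also have "\<dots> \<le> lower_slow_entropy_at L T \<mu> x"
      unfolding lower_slow_entropy_at_eq_SUP[OF \<mu>] using e by (intro SUP_upper) simp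
    finally show ?thesis .
  qed
  then have "(\<integral>\<^sup>+x. ennreal a \<partial>\<mu>) \<le> lower_slow_entropy L T \<mu>"
    unfolding lower_slow_entropy_def by (rule nn_integral_mono)
  then show ?thesis by (simp add: emeasure_space_1)
qed

section \<open>The variational principle\<close>
theorem exists_measure_large_entropy:
  assumes K: "compact K" "K \<noteq> {}" and t: "t < slow_entropy_top L T K"
  obtains \<mu> where "\<mu> \<in> borel_prob_measures" "measure \<mu> K = 1" "t \<le> lower_slow_entropy L T \<mu>"
proof -
  obtain e where e: "0 < e" "t < slow_entropy_top_at L T K e"
    using t unfolding slow_entropy_top_eq_SUP by (auto simp: less_SUP_iff)
  obtain u' where u': "t < u'" "u' < slow_entropy_top_at L T K e" using dense[OF e(2)] by blast
  obtain u where u: "t < u" "u < u'" using dense[OF u'(1)] by blast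
  obtain a where a: "t = ennreal a" "0 \<le> a" using u(1) by (cases t) auto
  obtain s where s: "u = ennreal s" "0 \<le> s" using u(2) by (cases u) auto
  obtain s' where s': "u' = ennreal s'" "0 \<le> s'" using u'(2) by (cases u') auto
  have as: "a < s" "s < s'" using u a s s' by (auto simp: ennreal_less_iff)
  have "slow_cover_sum L T K s' (3 * (e / 3)) \<noteq> 0"
    using slow_cover_sum_nonzero[OF s'(2)] u'(2) s'(1) by simp
  then obtain \<mu> C N where \<mu>: "\<mu> \<in> borel_prob_measures" "measure \<mu> K = 1"
    "\<And>k x. N \<le> k \<Longrightarrow> measure \<mu> (bball (2 ^ k) x (e / 3 / 4)) \<le> C * (1 / lam (2 ^ k)) powr s"
    using frostman_measure[OF K as(2), of "e / 3"] e(1) by (metis divide_pos_pos zero_less_numeral)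
  have "ennreal a \<le> lower_slow_entropy L T \<mu>"
    by (rule lower_slow_entropy_ge[OF \<mu>(1) _ a(2) as(1) \<mu>(3)]) (use e(1) in auto)
  with \<mu> a show ?thesis using that by blast
qed

end

theorem theorem4p1:
  fixes L :: "(int ^ 'd) set"
    and T :: "int ^ 'd \<Rightarrow> 'a \<Rightarrow> 'a::metric_space"
    and K :: "'a set"
  assumes "compact (UNIV :: 'a set)"
    and "L = UNIV \<or> L = nonneg_lattice"
    and "continuous_action L T"
    and "compact K" and "K \<noteq> {}"
  shows "slow_entropy_top L T K =
    (SUP \<mu> \<in> {\<mu> \<in> borel_prob_measures. measure \<mu> K = 1}. lower_slow_entropy L T \<mu>)"
proof (rule antisym)
  interpret compact_lattice_action L T by unfold_locales fact+
  show "(SUP \<mu> \<in> {\<mu> \<in> borel_prob_measures. measure \<mu> K = 1}. lower_slow_entropy L T \<mu>) \<le> slow_entropy_top L T K"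
    using assms(4) by (intro SUP_least lower_slow_entropy_le_top) (auto simp: compact_imp_closed)
  show "slow_entropy_top L T K \<le> (SUP \<mu> \<in> {\<mu> \<in> borel_prob_measures. measure \<mu> K = 1}. lower_slow_entropy L T \<mu>)"
  proof (rule dense_le)
    fix t assume "t < slow_entropy_top L T K"
    then obtain \<mu> where "\<mu> \<in> borel_prob_measures" "measure \<mu> K = 1" "t \<le> lower_slow_entropy L T \<mu>"
      by (rule exists_measure_large_entropy[OF assms(4,5)])
    then show "t \<le> (SUP \<mu> \<in> {\<mu> \<in> borel_prob_measures. measure \<mu> K = 1}. lower_slow_entropy L T \<mu>)"
      by (intro SUP_upper2[of \<mu>]) auto
  qed
qed

end
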